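(* Let $p$ be an odd prime, and let $F_\infty$ be the free group of countably infinite rank (free generators $x_i$, $i\in\mathbb N$) in the variety $\mathcal N_{2,p}$ of groups that satisfy the laws $[[x,y],z]=1$ and $x^p=1$. Then $F_\infty$ is not word automatic.
   Context: $\mathbb N=\{0,1,2,\dots\}$ and $[x,y]=x^{-1}y^{-1}xy$. Convolution: let $\Sigma$ be a finite alphabet and $\Diamond\notin\Sigma$ a filler symbol. For $\sigma_1,\dots,\sigma_n\in\Sigma^*$, extend each string on the right by symbols $\Diamond$ to the common length $\max_i|\sigma_i|$, and stack the resulting strings on top of each other to obtain a single string over the alphabet $(\Sigma\cup\{\Diamond\})^n$. A relation $S\subseteq(\Sigma^* )^n$ is FA-recognizable if the set of convolutions of its tuples is a regular language over $(\Sigma\cup\{\Diamond\})^n$. Word automatic: a group $G$ is word automatic (FA-presentable) if there are a finite alphabet $\Sigma$, a regular language $D\subseteq\Sigma^*$ and a surjection $\pi:D\to G$ (elements may be represented by more than one string) such that the relations $\{(\sigma,\tau)\in D^2:\pi(\sigma)=\pi(\tau)\}$ and $\{(\sigma,\tau,\rho)\in D^3:\pi(\sigma)\pi(\tau)=\pi(\rho)\}$ are FA-recognizable. (This is not the notion of automatic group in the sense of Thurston and Epstein.) *)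

theory Defs
  imports "HOL-Algebra.Group" "HOL-Computational_Algebra.Primes"
begin

(* Languages accepted by a complete deterministic finite automaton over the alphabet A.  Taking
   states from nat is no restriction, since a finite state set can be renumbered. *)
definition regular_language :: "'a set \<Rightarrow> 'a list set \<Rightarrow> bool" where
  "regular_language A L \<longleftrightarrow> finite A \<and>
     (\<exists>(Q :: nat set) q0 \<delta> Acc. finite Q \<and> q0 \<in> Q \<and> Acc \<subseteq> Q \<and>
        (\<forall>q\<in>Q. \<forall>a\<in>A. \<delta> q a \<in> Q) \<and>
        L = {w \<in> lists A. foldl \<delta> q0 w \<in> Acc})"

(* An n-tuple of strings is a list of length n.  The filler symbol is None, a symbol a of the
   alphabet becomes Some a, and a letter of the convolution is a list of length n. *)
definition convolution :: "'a list list \<Rightarrow> 'a option list list" where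
  "convolution ws =
     map (\<lambda>i. map (\<lambda>w. if i < length w then Some (w ! i) else None) ws)
       [0..<Max (insert 0 (length ` set ws))]"

definition conv_alphabet :: "'a set \<Rightarrow> nat \<Rightarrow> 'a option list set" where
  "conv_alphabet \<Sigma> n = {c. length c = n \<and> set c \<subseteq> insert None (Some ` \<Sigma>)}"

definition FA_recognizable :: "'a set \<Rightarrow> nat \<Rightarrow> 'a list list set \<Rightarrow> bool" where
  "FA_recognizable \<Sigma> n S \<longleftrightarrow>
     S \<subseteq> {ws. length ws = n \<and> set ws \<subseteq> lists \<Sigma>} \<and>
     regular_language (conv_alphabet \<Sigma> n) (convolution ` S)"

(* The alphabet is a finite set of natural numbers; a finite alphabet of any other type can be
   renamed injectively into nat. *)
definition word_automatic :: "('g, 'm) monoid_scheme \<Rightarrow> bool" where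
  "word_automatic G \<longleftrightarrow>
     (\<exists>(\<Sigma> :: nat set) D \<pi>. finite \<Sigma> \<and> regular_language \<Sigma> D \<and> \<pi> ` D = carrier G \<and>
        FA_recognizable \<Sigma> 2 {[\<sigma>, \<tau>] | \<sigma> \<tau>. \<sigma> \<in> D \<and> \<tau> \<in> D \<and> \<pi> \<sigma> = \<pi> \<tau>} \<and>
        FA_recognizable \<Sigma> 3 {[\<sigma>, \<tau>, \<rho>] | \<sigma> \<tau> \<rho>. \<sigma> \<in> D \<and> \<tau> \<in> D \<and> \<rho> \<in> D \<and>
                                  \<pi> \<sigma> \<otimes>\<^bsub>G\<^esub> \<pi> \<tau> = \<pi> \<rho>})"

lemma word_automatic_iso:
  assumes "word_automatic G" "group G" "G \<cong> H"
  shows "word_automatic H"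
proof -
  from assms(3) obtain h where h: "h \<in> iso G H" by (auto simp: is_iso_def)
  then have hom: "\<And>x y. x \<in> carrier G \<Longrightarrow> y \<in> carrier G \<Longrightarrow> h (x \<otimes>\<^bsub>G\<^esub> y) = h x \<otimes>\<^bsub>H\<^esub> h y"
    and inj: "inj_on h (carrier G)" and im: "h ` carrier G = carrier H"
    by (auto simp: iso_def hom_def bij_betw_def)
  interpret group G by fact
  obtain \<Sigma> :: "nat set" and D \<pi> where *: "finite \<Sigma>" "regular_language \<Sigma> D" and
      p: "\<pi> ` D = carrier G" and
      r: "FA_recognizable \<Sigma> 2 {[\<sigma>, \<tau>] | \<sigma> \<tau>. \<sigma> \<in> D \<and> \<tau> \<in> D \<and> \<pi> \<sigma> = \<pi> \<tau>}"
        "FA_recognizable \<Sigma> 3 {[\<sigma>, \<tau>, \<rho>] | \<sigma> \<tau> \<rho>. \<sigma> \<in> D \<and> \<tau> \<in> D \<and> \<rho> \<in> D \<and>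
                                  \<pi> \<sigma> \<otimes>\<^bsub>G\<^esub> \<pi> \<tau> = \<pi> \<rho>}"
    using assms(1) unfolding word_automatic_def by blast
  have D: "\<And>s. s \<in> D \<Longrightarrow> \<pi> s \<in> carrier G" using p by blast
  have e2: "\<And>s t. s \<in> D \<Longrightarrow> t \<in> D \<Longrightarrow> (h (\<pi> s) = h (\<pi> t)) = (\<pi> s = \<pi> t)"
    using inj D by (auto dest: inj_onD)
  have e3: "\<And>s t u. s \<in> D \<Longrightarrow> t \<in> D \<Longrightarrow> u \<in> D \<Longrightarrow>
      (h (\<pi> s) \<otimes>\<^bsub>H\<^esub> h (\<pi> t) = h (\<pi> u)) = (\<pi> s \<otimes>\<^bsub>G\<^esub> \<pi> t = \<pi> u)"
    using inj D hom by (metis inj_onD m_closed)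
  have "{[\<sigma>, \<tau>] | \<sigma> \<tau>. \<sigma> \<in> D \<and> \<tau> \<in> D \<and> (h \<circ> \<pi>) \<sigma> = (h \<circ> \<pi>) \<tau>} =
        {[\<sigma>, \<tau>] | \<sigma> \<tau>. \<sigma> \<in> D \<and> \<tau> \<in> D \<and> \<pi> \<sigma> = \<pi> \<tau>}"
    using e2 by auto
  moreover have "{[\<sigma>, \<tau>, \<rho>] | \<sigma> \<tau> \<rho>. \<sigma> \<in> D \<and> \<tau> \<in> D \<and> \<rho> \<in> D \<and>
          (h \<circ> \<pi>) \<sigma> \<otimes>\<^bsub>H\<^esub> (h \<circ> \<pi>) \<tau> = (h \<circ> \<pi>) \<rho>} =
        {[\<sigma>, \<tau>, \<rho>] | \<sigma> \<tau> \<rho>. \<sigma> \<in> D \<and> \<tau> \<in> D \<and> \<rho> \<in> D \<and> \<pi> \<sigma> \<otimes>\<^bsub>G\<^esub> \<pi> \<tau> = \<pi> \<rho>}"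
    using e3 by auto
  moreover have "(h \<circ> \<pi>) ` D = carrier H" using p im by (metis image_comp)
  ultimately show ?thesis
    unfolding word_automatic_def using * r by (intro exI[of _ \<Sigma>] exI[of _ D] exI[of _ "h \<circ> \<pi>"]) simp
qed

(* The library's derived subgroup uses x y x^-1 y^-1 instead. *)
definition commutator :: "('g, 'm) monoid_scheme \<Rightarrow> 'g \<Rightarrow> 'g \<Rightarrow> 'g" where
  "commutator G x y = inv\<^bsub>G\<^esub> x \<otimes>\<^bsub>G\<^esub> inv\<^bsub>G\<^esub> y \<otimes>\<^bsub>G\<^esub> x \<otimes>\<^bsub>G\<^esub> y"

definition in_N2 :: "nat \<Rightarrow> ('g, 'm) monoid_scheme \<Rightarrow> bool" where
  "in_N2 p G \<longleftrightarrow> group G \<and>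
     (\<forall>x\<in>carrier G. \<forall>y\<in>carrier G. \<forall>z\<in>carrier G.
        commutator G (commutator G x y) z = \<one>\<^bsub>G\<^esub>) \<and>
     (\<forall>x\<in>carrier G. x [^]\<^bsub>G\<^esub> p = \<one>\<^bsub>G\<^esub>)"

(* A group word is a list of letters; (i, True) stands for x_i and (i, False) for its inverse. *)
type_synonym gword = "(nat \<times> bool) list"

definition winv :: "gword \<Rightarrow> gword" where
  "winv u = rev (map (\<lambda>(i, b). (i, \<not> b)) u)"

definition wcomm :: "gword \<Rightarrow> gword \<Rightarrow> gword" where
  "wcomm u v = winv u @ winv v @ u @ v"

(* The least congruence on group words that contains free cancellation and all substitution
   instances of the two laws. Its quotient is the absolutely free group on the x_i modulo the
   verbal subgroup of the laws. *)
inductive N2_eq :: "nat \<Rightarrow> gword \<Rightarrow> gword \<Rightarrow> bool" for p :: nat where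
  refl: "N2_eq p u u"
| sym: "N2_eq p u v \<Longrightarrow> N2_eq p v u"
| trans: "N2_eq p u v \<Longrightarrow> N2_eq p v w \<Longrightarrow> N2_eq p u w"
| append: "N2_eq p u u' \<Longrightarrow> N2_eq p v v' \<Longrightarrow> N2_eq p (u @ v) (u' @ v')"
| cancel: "N2_eq p [(i, b), (i, \<not> b)] []"
| nilpotent: "N2_eq p (wcomm (wcomm u v) w) []"
| exponent: "N2_eq p (concat (replicate p u)) []"

definition N2_class :: "nat \<Rightarrow> gword \<Rightarrow> gword set" where
  "N2_class p u = {v. N2_eq p u v}"

definition F_infinity :: "nat \<Rightarrow> gword set monoid" where
  "F_infinity p = \<lparr>carrier = range (N2_class p),
     monoid.mult = (\<lambda>A B. {w. \<exists>u\<in>A. \<exists>v\<in>B. N2_eq p (u @ v) w}),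
     monoid.one = N2_class p []\<rparr>"

definition F_gen :: "nat \<Rightarrow> nat \<Rightarrow> gword set" where
  "F_gen p i = N2_class p [(i, True)]"

lemma N2_class_eq_iff: "N2_class p u = N2_class p v \<longleftrightarrow> N2_eq p u v"
  unfolding N2_class_def by (blast intro: N2_eq.refl N2_eq.sym N2_eq.trans)

lemma F_carrier: "carrier (F_infinity p) = range (N2_class p)"
  and F_one: "\<one>\<^bsub>F_infinity p\<^esub> = N2_class p []"
  by (simp_all add: F_infinity_def)

lemma F_mult: "N2_class p u \<otimes>\<^bsub>F_infinity p\<^esub> N2_class p v = N2_class p (u @ v)"
proof -
  have "N2_eq p (u @ v) w" if "N2_eq p u u'" "N2_eq p v v'" "N2_eq p (u' @ v') w" for u' v' w
    using that by (meson N2_eq.append N2_eq.trans)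
  then show ?thesis
    unfolding F_infinity_def by (auto simp: N2_class_def intro: N2_eq.refl)
qed

lemma winv_Cons: "winv ((i, b) # u) = winv u @ [(i, \<not> b)]"
  and winv_Nil: "winv [] = []"
  by (simp_all add: winv_def)

lemma N2_eq_winv_left: "N2_eq p (winv u @ u) []"
proof (induction u)
  case Nil
  then show ?case by (simp add: winv_Nil N2_eq.refl)
next
  case (Cons a u)
  obtain i b where a: "a = (i, b)" by force
  have "N2_eq p ([(i, \<not> b), (i, b)]) []" using N2_eq.cancel[of p i "\<not> b"] by simp
  then have "N2_eq p (winv u @ [(i, \<not> b), (i, b)] @ u) (winv u @ [] @ u)"
    by (intro N2_eq.append N2_eq.refl)
  with Cons show ?case by (auto simp: a winv_Cons intro: N2_eq.trans)
qed

lemma group_F_infinity: "group (F_infinity p)"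
proof (rule groupI)
  fix x assume "x \<in> carrier (F_infinity p)"
  then obtain u where x: "x = N2_class p u" by (auto simp: F_carrier)
  then have "N2_class p (winv u) \<otimes>\<^bsub>F_infinity p\<^esub> x = \<one>\<^bsub>F_infinity p\<^esub>"
    by (simp add: F_mult F_one N2_class_eq_iff N2_eq_winv_left)
  then show "\<exists>y\<in>carrier (F_infinity p). y \<otimes>\<^bsub>F_infinity p\<^esub> x = \<one>\<^bsub>F_infinity p\<^esub>"
    by (auto simp: F_carrier)
qed (auto simp: F_carrier F_mult F_one)

lemma F_inv: "inv\<^bsub>F_infinity p\<^esub> (N2_class p u) = N2_class p (winv u)"
proof -
  interpret group "F_infinity p" by (rule group_F_infinity)
  show ?thesis
    by (rule inv_equality) (auto simp: F_carrier F_mult F_one N2_class_eq_iff N2_eq_winv_left)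
qed

lemma F_commutator:
  "commutator (F_infinity p) (N2_class p u) (N2_class p v) = N2_class p (wcomm u v)"
  by (simp add: commutator_def wcomm_def F_inv F_mult)

lemma F_pow: "N2_class p u [^]\<^bsub>F_infinity p\<^esub> (n :: nat) = N2_class p (concat (replicate n u))"
proof -
  interpret group "F_infinity p" by (rule group_F_infinity)
  have "concat (replicate n u) @ u = u @ concat (replicate n u)" for n
    by (induction n) auto
  then show ?thesis by (induction n) (simp_all add: F_one F_mult)
qed

theorem F_infinity_in_N2: "in_N2 p (F_infinity p)"
  by (auto simp: in_N2_def group_F_infinity F_carrier F_commutator F_pow F_one N2_class_eq_iff
      intro: N2_eq.nilpotent N2_eq.exponent)

definition weval :: "('g, 'm) monoid_scheme \<Rightarrow> (nat \<Rightarrow> 'g) \<Rightarrow> gword \<Rightarrow> 'g" where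
  "weval H f w = foldr (\<lambda>(i, b) a. (if b then f i else inv\<^bsub>H\<^esub> f i) \<otimes>\<^bsub>H\<^esub> a) w \<one>\<^bsub>H\<^esub>"

context
  fixes H :: "('g, 'm) monoid_scheme" (structure) and p :: nat and f :: "nat \<Rightarrow> 'g"
  assumes H: "in_N2 p H" and f: "\<And>i. f i \<in> carrier H"
begin

interpretation H: group H using H by (simp add: in_N2_def)

lemma weval_closed: "weval H f w \<in> carrier H"
  by (induction w) (auto simp: weval_def f)

lemma weval_append: "weval H f (u @ v) = weval H f u \<otimes> weval H f v"
proof (induction u)
  case Nil
  then show ?case using weval_closed[of v] by (simp add: weval_def)
next
  case (Cons a u)
  then show ?case
    using weval_closed[of u] weval_closed[of v]
    by (cases a) (simp add: weval_def H.m_assoc f)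
qed

lemma weval_winv: "weval H f (winv u) = inv (weval H f u)"
proof (induction u)
  case Nil
  then show ?case by (simp add: weval_def winv_def)
next
  case (Cons a u)
  obtain i b where a: "a = (i, b)" by force
  have "weval H f ((i, b) # u) = weval H f [(i, b)] \<otimes> weval H f u"
    using weval_append[of "[(i, b)]" u] by simp
  moreover have "weval H f [(i, \<not> b)] = inv (weval H f [(i, b)])"
    by (auto simp: weval_def f)
  ultimately show ?case
    using Cons weval_closed by (simp add: a winv_Cons weval_append H.inv_mult_group)
qed

lemma weval_wcomm: "weval H f (wcomm u v) = commutator H (weval H f u) (weval H f v)"
  by (simp add: wcomm_def commutator_def weval_append weval_winv weval_closed H.m_assoc)

lemma weval_power: "weval H f (concat (replicate n u)) = weval H f u [^] n"
proof (induction n)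
  case 0
  then show ?case by (simp add: weval_def)
next
  case (Suc n)
  then show ?case by (simp only: replicate_Suc concat.simps weval_append H.nat_pow_Suc2[OF weval_closed])
qed

lemma weval_N2_eq: "N2_eq p u v \<Longrightarrow> weval H f u = weval H f v"
proof (induction rule: N2_eq.induct)
  case (cancel i b)
  then show ?case by (cases b) (auto simp: weval_def f)
next
  case (nilpotent u v w)
  then show ?case using H by (simp add: weval_wcomm in_N2_def weval_closed) (simp add: weval_def)
next
  case (exponent u)
  then show ?case using H by (simp add: weval_power in_N2_def weval_closed) (simp add: weval_def)
qed (simp_all add: weval_append)

theorem F_infinity_universal:
  "\<exists>!h. h \<in> hom (F_infinity p) H \<and> h \<in> extensional (carrier (F_infinity p)) \<and>
        (\<forall>i. h (F_gen p i) = f i)"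
proof -
  interpret F: group "F_infinity p" by (rule group_F_infinity)
  define h where "h = (\<lambda>A\<in>carrier (F_infinity p). weval H f (SOME u. u \<in> A))"
  have h: "h (N2_class p u) = weval H f u" for u
  proof -
    have "u \<in> N2_class p u" by (simp add: N2_class_def N2_eq.refl)
    then have "(SOME v. v \<in> N2_class p u) \<in> N2_class p u" by (rule someI)
    then have "weval H f u = weval H f (SOME v. v \<in> N2_class p u)"
      by (intro weval_N2_eq) (simp add: N2_class_def)
    then show ?thesis by (simp add: h_def F_carrier)
  qed
  show ?thesis
  proof (rule ex1I[of _ h])
    show "h \<in> hom (F_infinity p) H \<and> h \<in> extensional (carrier (F_infinity p)) \<and>
        (\<forall>i. h (F_gen p i) = f i)"
    proof (intro conjI allI)
      show "h \<in> hom (F_infinity p) H"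
        by (auto simp: hom_def F_carrier h weval_closed F_mult weval_append)
      show "h \<in> extensional (carrier (F_infinity p))" by (simp add: h_def)
      show "h (F_gen p i) = f i" for i
        unfolding F_gen_def h by (simp add: weval_def f)
    qed
  next
    fix k assume k: "k \<in> hom (F_infinity p) H \<and> k \<in> extensional (carrier (F_infinity p)) \<and>
        (\<forall>i. k (F_gen p i) = f i)"
    then interpret k: group_hom "F_infinity p" H k
      by unfold_locales auto
    have "k (N2_class p u) = weval H f u" for u
    proof (induction u)
      case Nil
      then show ?case using k.hom_one by (simp add: F_one weval_def)
    next
      case (Cons a u)
      obtain i b where a: "a = (i, b)" by force
      have 1: "k (N2_class p [(i, True)]) = f i" using k by (simp add: F_gen_def)
      have "N2_class p [(i, False)] = inv\<^bsub>F_infinity p\<^esub> N2_class p [(i, True)]"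
        by (simp add: F_inv winv_def)
      then have 2: "k (N2_class p [(i, False)]) = inv f i"
        using 1 k.hom_inv[of "N2_class p [(i, True)]"] by (simp add: F_carrier)
      have "N2_class p (a # u) = N2_class p [(i, b)] \<otimes>\<^bsub>F_infinity p\<^esub> N2_class p u"
        by (simp add: F_mult a)
      then have "k (N2_class p (a # u)) = k (N2_class p [(i, b)]) \<otimes> k (N2_class p u)"
        by (simp add: F_carrier)
      then show ?case using Cons 1 2 by (cases b) (simp_all add: a weval_def)
    qed
    then show "k = h"
      using k h by (intro extensionalityI[of k "carrier (F_infinity p)"])
        (auto simp: h_def F_carrier)
  qed
qed

end

end

theory Submission
  imports Defs "HOL-Number_Theory.Cong"
begin

text \<open>Let \<open>B m\<close> be the set of elements that have a representative of length at most \<open>m\<close>. Pumping gives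
  \<open>B m \<cdot> B m \<subseteq> B (m + c)\<close>, and also that \<open>B (m + C)\<close> contains some \<open>x\<close> whose conjugate \<open>a\<^sup>x\<close> of the
  generator \<open>a = x\<^sub>0\<close> lies outside \<open>B m\<close>. If all products of powers of \<open>y\<^sub>1, \<dots>, y\<^sub>k\<close> lie in \<open>B m\<close>, then an
  \<open>x\<close> with \<open>a\<^sup>x\<close> outside a slightly larger \<open>B m'\<close> is independent of the \<open>y\<^sub>i\<close> modulo the centre, so
  \<open>y\<^sub>k\<^sub>+\<^sub>1\<close> can be chosen such that the products of powers of \<open>y\<^sub>1, \<dots>, y\<^sub>k\<^sub>+\<^sub>1\<close> lie in \<open>B (m + const)\<close>: the
  length grows only linearly in \<open>k\<close>. The commutators \<open>[y\<^sub>i, y\<^sub>j]\<close>, \<open>i < j\<close>, are independent, because the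
  derived subgroup is the exterior square of the abelianisation. Hence their products, which still have
  length \<open>O(k)\<close>, number \<open>p\<close> to the power \<open>k (k - 1) / 2\<close>, whereas \<open>|B m|\<close> is at most exponential in
  \<open>m\<close>.\<close>

section \<open>Pumping convolutions\<close>

definition cut :: "nat \<Rightarrow> nat \<Rightarrow> 'a list \<Rightarrow> 'a list" where
  "cut i j w = take i w @ drop j w"

lemma length_cut: "length (cut i j w) = min (length w) i + (length w - j)"
  by (simp add: cut_def)

lemma length_cut_le: "i \<le> j \<Longrightarrow> length (cut i j w) \<le> length w"
  by (simp add: length_cut)

lemma length_cut_less: "i < j \<Longrightarrow> j \<le> length w \<Longrightarrow> length (cut i j w) < length w"
  by (simp add: length_cut)

lemma cut_short: "length w \<le> i \<Longrightarrow> i \<le> j \<Longrightarrow> cut i j w = w"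
  by (simp add: cut_def)

lemma cut_in_lists: "w \<in> lists A \<Longrightarrow> cut i j w \<in> lists A"
  by (auto simp: cut_def in_lists_conv_set dest: in_set_takeD in_set_dropD)

lemma length_convolution: "length (convolution ws) = Max (insert 0 (length ` set ws))"
  by (simp add: convolution_def)

lemma length_le_convolution: "w \<in> set ws \<Longrightarrow> length w \<le> length (convolution ws)"
  by (simp add: length_convolution)

lemma nth_convolution:
  "i < length (convolution ws) \<Longrightarrow>
    convolution ws ! i = map (\<lambda>w. if i < length w then Some (w ! i) else None) ws"
  by (simp add: convolution_def)

lemma nth_cut:
  "t < length (cut i j w) \<Longrightarrow> i \<le> j \<Longrightarrow> cut i j w ! t = (if t < i then w ! t else w ! (t + (j - i)))"
  by (auto simp: cut_def nth_append length_cut min_def add.commute split: if_splits)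

text \<open>Deleting a block of columns deletes it from every row, because filler stands only on the
  right: a row ending inside the block ends at column \<open>i\<close> afterwards. The new length is
  monotone in the old one, so it commutes with the maximum.\<close>

lemma convolution_cut:
  assumes "i \<le> j"
  shows "convolution (map (cut i j) ws) = cut i j (convolution ws)"
proof -
  define f where "f n = min n i + (n - j)" for n
  have f: "mono f" by (auto simp: f_def mono_def)
  have "f (Max (insert 0 (length ` set ws))) = Max (f ` insert 0 (length ` set ws))"
    by (rule mono_Max_commute[OF f]) auto
  also have "f ` insert 0 (length ` set ws) = insert 0 (length ` set (map (cut i j) ws))"
    by (auto simp: f_def length_cut image_iff)
  finally have len: "length (convolution (map (cut i j) ws)) = length (cut i j (convolution ws))"
    by (simp add: length_convolution length_cut f_def)
  show ?thesis
  proof (rule nth_equalityI[OF len])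
    fix t assume t: "t < length (convolution (map (cut i j) ws))"
    then have t': "t < length (cut i j (convolution ws))" using len by simp
    let ?t = "if t < i then t else t + (j - i)"
    have "?t < length (convolution ws)"
      using t' assms by (auto simp: length_cut min_def split: if_splits)
    then have "cut i j (convolution ws) ! t =
        map (\<lambda>w. if ?t < length w then Some (w ! ?t) else None) ws"
      using nth_cut[OF t' assms] by (auto simp: nth_convolution)
    moreover have "(if t < length (cut i j w) then Some (cut i j w ! t) else None) =
        (if ?t < length w then Some (w ! ?t) else None)" for w :: "'a list"
      using assms nth_cut[of t i j w] by (auto simp: length_cut min_def)
    ultimately show "convolution (map (cut i j) ws) ! t = cut i j (convolution ws) ! t"
      using t by (simp add: nth_convolution)
  qed
qed

text \<open>Where the shorter of two rows of different lengths ends, one convolution has filler and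
  the other a letter. The number of rows is given, since empty strings have an empty convolution
  whatever their number.\<close>

lemma convolution_inj:
  assumes "length ws = length ws'" "convolution ws = convolution ws'"
  shows "ws = ws'"
proof (rule nth_equalityI[OF assms(1)])
  fix k assume k: "k < length ws"
  let ?w = "ws ! k" and ?v = "ws' ! k"
  have le: "length ?w \<le> length (convolution ws)" "length ?v \<le> length (convolution ws)"
    using k assms by (metis length_le_convolution nth_mem)+ 
  have eq: "(if t < length ?w then Some (?w ! t) else None) =
      (if t < length ?v then Some (?v ! t) else None)" if "t < length (convolution ws)" for t
  proof -
    have "convolution ws ! t ! k = convolution ws' ! t ! k" by (simp add: assms)
    moreover have "k < length ws'" "t < length (convolution ws')" using that k assms by auto
    ultimately show ?thesis using that k by (simp only: nth_convolution nth_map)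
  qed
  have "\<not> length ?w < length ?v"
  proof
    assume "length ?w < length ?v"
    then show False using le eq[of "length ?w"] by simp
  qed
  moreover have "\<not> length ?v < length ?w"
  proof
    assume "length ?v < length ?w"
    then show False using le eq[of "length ?v"] by simp
  qed
  ultimately have len: "length ?w = length ?v" by simp
  show "?w = ?v"
  proof (rule nth_equalityI)
    fix t assume "t < length ?w"
    then show "?w ! t = ?v ! t" using eq[of t] le len by simp
  qed (rule len)
qed

text \<open>Only columns from \<open>j\<close> on count, so lengths are compared after truncated
  subtraction of \<open>j\<close>; the two tuples may end at different places before
  \<open>j\<close>.\<close>

lemma drop_convolution_eq:
  assumes "\<And>t. t \<ge> j \<Longrightarrow> map (\<lambda>w. if t < length w then Some (w ! t) else None) ws =
      map (\<lambda>w. if t < length w then Some (w ! t) else None) vs"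
    and "length (convolution ws) - j = length (convolution vs) - j"
  shows "drop j (convolution ws) = drop j (convolution vs)"
proof (rule nth_equalityI)
  fix t assume "t < length (drop j (convolution ws))"
  then have "j + t < length (convolution ws)" "j + t < length (convolution vs)"
    using assms(2) by auto
  then show "drop j (convolution ws) ! t = drop j (convolution vs) ! t"
    using assms(1)[of "j + t"] by (simp add: nth_convolution)
qed (use assms(2) in simp)

lemma convolution_alphabet:
  assumes "length ws = n" "set ws \<subseteq> lists \<Sigma>"
  shows "convolution ws \<in> lists (conv_alphabet \<Sigma> n)"
proof -
  have "map (\<lambda>w. if t < length w then Some (w ! t) else None) ws \<in> conv_alphabet \<Sigma> n" for t
  proof -
    have "(if t < length w then Some (w ! t) else None) \<in> insert None (Some ` \<Sigma>)"
      if "w \<in> set ws" for w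
    proof -
      have "w \<in> lists \<Sigma>" using that assms(2) by blast
      then show ?thesis using nth_mem[of t w] by (auto simp: in_lists_conv_set)
    qed
    then show ?thesis
      unfolding conv_alphabet_def mem_Collect_eq length_map set_map assms(1)
      by (intro conjI HOL.refl image_subsetI)
  qed
  then show ?thesis by (simp add: convolution_def in_lists_conv_set)
qed

section \<open>Automata reading convolutions\<close>

lemma foldl_state: "q \<in> Q \<Longrightarrow> \<forall>q\<in>Q. \<forall>a\<in>A. \<delta> q a \<in> Q \<Longrightarrow> w \<in> lists A \<Longrightarrow> foldl \<delta> q w \<in> Q"
  by (induction w arbitrary: q) auto

text \<open>The form of recognizability used for pumping: states reached on prefixes stay in one
  finite set, and by injectivity of the convolution acceptance decides membership of the tuple
  itself.\<close>

lemma FA_recognizableE: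
  assumes "FA_recognizable \<Sigma> n S"
  obtains Q :: "nat set" and \<delta> q0 Acc where "finite Q"
    "\<And>ws t. length ws = n \<Longrightarrow> set ws \<subseteq> lists \<Sigma> \<Longrightarrow> foldl \<delta> q0 (take t (convolution ws)) \<in> Q"
    "\<And>ws. length ws = n \<Longrightarrow> set ws \<subseteq> lists \<Sigma> \<Longrightarrow>
      ws \<in> S \<longleftrightarrow> foldl \<delta> q0 (convolution ws) \<in> Acc"
proof -
  have S: "S \<subseteq> {ws. length ws = n \<and> set ws \<subseteq> lists \<Sigma>}"
    and "regular_language (conv_alphabet \<Sigma> n) (convolution ` S)"
    using assms by (auto simp: FA_recognizable_def)
  then obtain Q :: "nat set" and q0 \<delta> Acc where Q: "finite Q" "q0 \<in> Q"
    "\<forall>q\<in>Q. \<forall>a\<in>conv_alphabet \<Sigma> n. \<delta> q a \<in> Q"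
    "convolution ` S = {w \<in> lists (conv_alphabet \<Sigma> n). foldl \<delta> q0 w \<in> Acc}"
    unfolding regular_language_def by blast
  show ?thesis
  proof (rule that[of Q \<delta> q0 Acc])
    fix ws :: "'a list list" assume ws: "length ws = n" "set ws \<subseteq> lists \<Sigma>"
    note alph = convolution_alphabet[OF ws]
    have "take t (convolution ws) \<in> lists (conv_alphabet \<Sigma> n)" for t
      using alph by (auto dest: in_set_takeD)
    then show "foldl \<delta> q0 (take t (convolution ws)) \<in> Q" for t
      using foldl_state[OF Q(2,3)] by blast
    have "ws \<in> S \<longleftrightarrow> convolution ws \<in> convolution ` S"
    proof
      assume "convolution ws \<in> convolution ` S"
      then obtain vs where vs: "vs \<in> S" "convolution ws = convolution vs" by blast
      have "length ws = length vs" using vs(1) S ws(1) by auto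
      then show "ws \<in> S" using vs convolution_inj by blast
    qed blast
    then have "ws \<in> S \<longleftrightarrow> convolution ws \<in> {w \<in> lists (conv_alphabet \<Sigma> n). foldl \<delta> q0 w \<in> Acc}"
      unfolding Q(4) .
    then show "ws \<in> S \<longleftrightarrow> foldl \<delta> q0 (convolution ws) \<in> Acc"
      using alph by blast
  qed (use Q in auto)
qed

text \<open>With \<open>u = v\<close> this is ordinary pumping. Two strings are allowed so that one
  short word can be exchanged for another in front of the same tail.\<close>

lemma foldl_cut:
  assumes "foldl \<delta> q (take i u) = foldl \<delta> q (take j v)" "drop j u = drop j v"
  shows "foldl \<delta> q (cut i j u) = foldl \<delta> q v"
  unfolding cut_def using assms by (metis append_take_drop_id foldl_append)

lemma pigeonhole_interval:
  fixes f :: "nat \<Rightarrow> 'a"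
  assumes "finite B" "\<And>t. f t \<in> B"
  shows "\<exists>i j. m \<le> i \<and> i < j \<and> j \<le> m + card B \<and> f i = f j"
proof -
  have "f ` {m..m + card B} \<subseteq> B" using assms by auto
  then have "card (f ` {m..m + card B}) < card {m..m + card B}"
    using card_mono[OF assms(1)] by (metis card_atLeastAtMost diff_add_inverse
        less_Suc_eq_le add_Suc_right)
  then have "\<not> inj_on f {m..m + card B}" by (rule pigeonhole)
  then obtain i j where "i \<in> {m..m + card B}" "j \<in> {m..m + card B}" "i \<noteq> j" "f i = f j"
    by (auto simp: inj_on_def)
  then show ?thesis by (metis atLeastAtMost_iff linorder_neqE_nat)
qed


section \<open>Balls of elements with short representatives\<close>

definition ball_of :: "'a list set \<Rightarrow> ('a list \<Rightarrow> 'g) \<Rightarrow> nat \<Rightarrow> 'g set" where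
  "ball_of D \<pi> m = \<pi> ` {w \<in> D. length w \<le> m}"

lemma mono_ball_of: "m \<le> n \<Longrightarrow> ball_of D \<pi> m \<subseteq> ball_of D \<pi> n"
  by (auto simp: ball_of_def)

lemma card_ball_of:
  assumes "finite \<Sigma>" "D \<subseteq> lists \<Sigma>"
  shows "finite (ball_of D \<pi> m)" "card (ball_of D \<pi> m) \<le> (card \<Sigma> + 1) ^ m"
proof -
  let ?W = "{w. set w \<subseteq> \<Sigma> \<and> length w \<le> m}"
  have fin: "finite ?W" using assms(1) by (rule finite_lists_length_le)
  have sub: "{w \<in> D. length w \<le> m} \<subseteq> ?W" using assms(2) by auto
  have fin': "finite {w \<in> D. length w \<le> m}" using fin sub by (rule finite_subset[rotated])
  then show "finite (ball_of D \<pi> m)" by (simp add: ball_of_def)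
  have "card (ball_of D \<pi> m) \<le> card ?W"
    unfolding ball_of_def using card_image_le[OF fin'] card_mono[OF fin sub] by (rule le_trans)
  also have "\<dots> = (\<Sum>i\<le>m. card \<Sigma> ^ i)" using assms(1) by (rule card_lists_length_le)
  \<comment> \<open>The base \<open>card \<Sigma> + 1\<close> dominates the geometric sum even for
    an alphabet with at most one letter.\<close>
  also have "\<dots> \<le> (card \<Sigma> + 1) ^ m"
  proof (induction m)
    case (Suc m)
    have "card \<Sigma> ^ Suc m \<le> card \<Sigma> * (card \<Sigma> + 1) ^ m" by (simp add: power_mono)
    then have "(\<Sum>i\<le>Suc m. card \<Sigma> ^ i) \<le> (card \<Sigma> + 1) ^ m + card \<Sigma> * (card \<Sigma> + 1) ^ m"
      using Suc by (simp only: sum.atMost_Suc add_mono)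
    then show ?case by simp
  qed simp
  finally show "card (ball_of D \<pi> m) \<le> (card \<Sigma> + 1) ^ m" .
qed

text \<open>A shortest \<open>\<rho>\<close> works, with \<open>c\<close> the number of states:
  beyond position \<open>m\<close> the rows of \<open>\<sigma>\<close> and \<open>\<tau>\<close> are
  pure filler, so cutting between two equal states shortens \<open>\<rho>\<close> alone.\<close>

lemma FA_product_length:
  assumes rec: "FA_recognizable \<Sigma> 3 S"
    and S: "S = {[\<sigma>, \<tau>, \<rho>] | \<sigma> \<tau> \<rho>. \<sigma> \<in> D \<and> \<tau> \<in> D \<and> \<rho> \<in> D \<and> P \<sigma> \<tau> \<rho>}"
  shows "\<exists>c. \<forall>\<sigma> \<tau> \<rho> m. \<sigma> \<in> D \<and> \<tau> \<in> D \<and> \<rho> \<in> D \<and> P \<sigma> \<tau> \<rho> \<and> length \<sigma> \<le> m \<and> length \<tau> \<le> m \<longrightarrow>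
      (\<exists>\<rho>'\<in>D. P \<sigma> \<tau> \<rho>' \<and> length \<rho>' \<le> m + c)"
proof -
  obtain Q :: "nat set" and \<delta> q0 Acc where Q: "finite Q"
    "\<And>ws t. length ws = 3 \<Longrightarrow> set ws \<subseteq> lists \<Sigma> \<Longrightarrow> foldl \<delta> q0 (take t (convolution ws)) \<in> Q"
    "\<And>ws. length ws = 3 \<Longrightarrow> set ws \<subseteq> lists \<Sigma> \<Longrightarrow> ws \<in> S \<longleftrightarrow> foldl \<delta> q0 (convolution ws) \<in> Acc"
    using FA_recognizableE[OF rec] by metis
  have lists: "set ws \<subseteq> lists \<Sigma>" if "ws \<in> S" for ws
    using rec that by (auto simp: FA_recognizable_def)
  show ?thesis
  proof (intro exI[of _ "card Q"] allI impI, elim conjE)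
    fix \<sigma> \<tau> \<rho> m
    assume *: "\<sigma> \<in> D" "\<tau> \<in> D" "\<rho> \<in> D" "P \<sigma> \<tau> \<rho>" "length \<sigma> \<le> m" "length \<tau> \<le> m"
    have "[\<sigma>, \<tau>, \<rho>] \<in> S" using * by (auto simp: S)
    then obtain z where z: "[\<sigma>, \<tau>, z] \<in> S"
      and least: "\<And>y. [\<sigma>, \<tau>, y] \<in> S \<Longrightarrow> length z \<le> length y"
      using ex_has_least_nat[of "\<lambda>z. [\<sigma>, \<tau>, z] \<in> S" \<rho> length] by blast
    let ?ws = "[\<sigma>, \<tau>, z]"
    have "length z \<le> m + card Q"
    proof (rule ccontr)
      assume long: "\<not> length z \<le> m + card Q"
      obtain i j where ij: "m \<le> i" "i < j" "j \<le> m + card Q"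
        "foldl \<delta> q0 (take i (convolution ?ws)) = foldl \<delta> q0 (take j (convolution ?ws))"
        using pigeonhole_interval[of Q "\<lambda>t. foldl \<delta> q0 (take t (convolution ?ws))" m] Q(1,2) lists[OF z]
        by auto
      have eq: "map (cut i j) ?ws = [\<sigma>, \<tau>, cut i j z]"
        using * ij by (simp add: cut_short)
      have "set [\<sigma>, \<tau>, cut i j z] \<subseteq> lists \<Sigma>"
        using lists[OF z] cut_in_lists[of z] by simp
      moreover have "foldl \<delta> q0 (convolution [\<sigma>, \<tau>, cut i j z]) \<in> Acc"
        using foldl_cut[OF ij(4) HOL.refl] z Q(3)[OF _ lists[OF z]] ij(2)
        by (simp add: convolution_cut flip: eq del: list.map)
      ultimately have "[\<sigma>, \<tau>, cut i j z] \<in> S" using Q(3) by simp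
      then show False using least[of "cut i j z"] length_cut_less[OF ij(2), of z] ij long by auto
    qed
    then show "\<exists>\<rho>'\<in>D. P \<sigma> \<tau> \<rho>' \<and> length \<rho>' \<le> m + card Q"
      using z by (auto simp: S)
  qed
qed

text \<open>The three strings \<open>x, s, y\<close> (with \<open>P\<close> the multiplication: \<open>\<alpha>x = s = xy\<close>) are pumped simultaneously.
  The condition on all short \<open>u\<close> survives because the cut positions are also chosen such that the same set
  of states is reached on the pairs \<open>(u, y)\<close> at both of them.\<close>
lemma FA_escape:
  assumes rec3: "FA_recognizable \<Sigma> 3 S"
    and S: "S = {[\<sigma>, \<tau>, \<rho>] | \<sigma> \<tau> \<rho>. \<sigma> \<in> D \<and> \<tau> \<in> D \<and> \<rho> \<in> D \<and> P \<sigma> \<tau> \<rho>}"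
    and rec2: "FA_recognizable \<Sigma> 2 T"
    and T: "T = {[\<sigma>, \<tau>] | \<sigma> \<tau>. \<sigma> \<in> D \<and> \<tau> \<in> D \<and> E \<sigma> \<tau>}"
    and D: "D \<subseteq> lists \<Sigma>"
    and \<alpha>: "\<alpha> \<in> D"
  shows "\<exists>C. \<forall>m\<ge>length \<alpha>. \<forall>x\<in>D. \<forall>s\<in>D. \<forall>y\<in>D.
      P \<alpha> x s \<and> P x y s \<and> (\<forall>u\<in>D. length u \<le> m \<longrightarrow> \<not> E u y) \<longrightarrow>
      (\<exists>x\<in>D. \<exists>s\<in>D. \<exists>y\<in>D. length x \<le> m + C \<and>
        P \<alpha> x s \<and> P x y s \<and> (\<forall>u\<in>D. length u \<le> m \<longrightarrow> \<not> E u y))"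
proof -
  obtain Q :: "nat set" and \<delta> q0 Acc where Q: "finite Q"
    "\<And>ws t. length ws = 3 \<Longrightarrow> set ws \<subseteq> lists \<Sigma> \<Longrightarrow> foldl \<delta> q0 (take t (convolution ws)) \<in> Q"
    "\<And>ws. length ws = 3 \<Longrightarrow> set ws \<subseteq> lists \<Sigma> \<Longrightarrow> ws \<in> S \<longleftrightarrow> foldl \<delta> q0 (convolution ws) \<in> Acc"
    using FA_recognizableE[OF rec3] by metis
  obtain R :: "nat set" and \<epsilon> r0 Acc' where R: "finite R"
    "\<And>ws t. length ws = 2 \<Longrightarrow> set ws \<subseteq> lists \<Sigma> \<Longrightarrow> foldl \<epsilon> r0 (take t (convolution ws)) \<in> R"
    "\<And>ws. length ws = 2 \<Longrightarrow> set ws \<subseteq> lists \<Sigma> \<Longrightarrow> ws \<in> T \<longleftrightarrow> foldl \<epsilon> r0 (convolution ws) \<in> Acc'"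
    using FA_recognizableE[OF rec2] by metis
  have lists: "set ws \<subseteq> lists \<Sigma>" if "ws \<in> S" for ws
    using rec3 that by (auto simp: FA_recognizable_def)
  have SD: "set ws \<subseteq> D" if "ws \<in> S" for ws
    using that by (auto simp: S)
  let ?B = "Q \<times> Q \<times> Pow R"
  have finB: "finite ?B" using Q(1) R(1) by simp
  show ?thesis
  proof (intro exI[of _ "card ?B"] allI ballI impI, elim conjE)
    fix m x0 s0 y0
    assume m: "length \<alpha> \<le> m" and 0: "x0 \<in> D" "s0 \<in> D" "y0 \<in> D" "P \<alpha> x0 s0" "P x0 y0 s0"
      "\<forall>u\<in>D. length u \<le> m \<longrightarrow> \<not> E u y0"
    define good where "good = (\<lambda>(x, s, y). [\<alpha>, x, s] \<in> S \<and> [x, y, s] \<in> S \<and>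
      (\<forall>u\<in>D. length u \<le> m \<longrightarrow> [u, y] \<notin> T))"
    have "good (x0, s0, y0)" using 0 \<alpha> by (auto simp: good_def S T)
    then obtain w where w: "good w"
      and least': "\<forall>v. good v \<longrightarrow> (\<lambda>(x, s, y). length x + length s + length y) w
        \<le> (\<lambda>(x, s, y). length x + length s + length y) v"
      using ex_has_least_nat[of good "(x0, s0, y0)"
        "\<lambda>(x, s, y). length x + length s + length y"] by blast
    obtain x s y where [simp]: "w = (x, s, y)" by (cases w)
    have least: "length x + length s + length y \<le> length x' + length s' + length y'"
      if "good (x', s', y')" for x' s' y'
      using least' that by fastforce
    have g: "[\<alpha>, x, s] \<in> S" "[x, y, s] \<in> S" "\<And>u. u \<in> D \<Longrightarrow> length u \<le> m \<Longrightarrow> [u, y] \<notin> T"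
      using w by (auto simp: good_def)
    have Ds: "x \<in> D" "s \<in> D" "y \<in> D" using SD[OF g(2)] by auto
    have yL: "y \<in> lists \<Sigma>" "x \<in> lists \<Sigma>" "s \<in> lists \<Sigma>" "\<alpha> \<in> lists \<Sigma>"
      using lists[OF g(1)] lists[OF g(2)] by auto
    have DL: "u \<in> lists \<Sigma>" if "u \<in> D" for u using D that by blast
    have "length x \<le> m + card ?B"
    proof (rule ccontr)
      assume long: "\<not> length x \<le> m + card ?B"
      \<comment> \<open>The third component is the set of states reached on the pairs of a short
        \<open>u\<close> with \<open>y\<close>, not the family of these states. Its range has a size
        independent of \<open>m\<close>, and so has the constant \<open>C\<close>.\<close>
      define st where "st t = (foldl \<delta> q0 (take t (convolution [\<alpha>, x, s])),
          foldl \<delta> q0 (take t (convolution [x, y, s])),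
          (\<lambda>u. foldl \<epsilon> r0 (take t (convolution [u, y]))) ` {u \<in> D. length u \<le> m})" for t
      have st: "st t \<in> ?B" for t
      proof -
        have "foldl \<epsilon> r0 (take t (convolution [u, y])) \<in> R" if "u \<in> D" for u
          using that yL DL by (intro R(2)) simp_all
        moreover have "foldl \<delta> q0 (take t (convolution ws)) \<in> Q" if "ws \<in> S" "length ws = 3" for ws
          using that lists by (intro Q(2))
        ultimately show ?thesis unfolding st_def using g by auto
      qed
      obtain i j where ij: "m \<le> i" "i < j" "j \<le> m + card ?B" "st i = st j"
        using pigeonhole_interval[of ?B st m, OF finB st] by auto
      have eq: "map (cut i j) [\<alpha>, x, s] = [\<alpha>, cut i j x, cut i j s]"
        using m ij by (simp add: cut_short)
      have "[\<alpha>, cut i j x, cut i j s] \<in> S"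
      proof -
        have "foldl \<delta> q0 (cut i j (convolution [\<alpha>, x, s])) = foldl \<delta> q0 (convolution [\<alpha>, x, s])"
          by (rule foldl_cut) (use ij(4) in \<open>simp_all add: st_def\<close>)
        also have "\<dots> \<in> Acc" using Q(3) g(1) lists[OF g(1)] by simp
        also have "cut i j (convolution [\<alpha>, x, s]) = convolution [\<alpha>, cut i j x, cut i j s]"
          using ij(2) by (simp add: convolution_cut flip: eq del: list.map)
        finally show ?thesis using yL cut_in_lists[of _ \<Sigma> i j] by (subst Q(3)) auto
      qed
      moreover have "[cut i j x, cut i j y, cut i j s] \<in> S"
      proof -
        have "foldl \<delta> q0 (cut i j (convolution [x, y, s])) = foldl \<delta> q0 (convolution [x, y, s])"
          by (rule foldl_cut) (use ij(4) in \<open>simp_all add: st_def\<close>)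
        also have "\<dots> \<in> Acc" using Q(3) g(2) lists[OF g(2)] by simp
        finally show ?thesis
          using yL ij(2) cut_in_lists[of _ \<Sigma> i j] convolution_cut[of i j "[x, y, s]"]
          by (subst Q(3)) auto
      qed
      moreover have "[u, cut i j y] \<notin> T" if u: "u \<in> D" "length u \<le> m" for u
      proof
        assume uT: "[u, cut i j y] \<in> T"
        \<comment> \<open>Equality of the sets of states at \<open>i\<close> and \<open>j\<close>
          gives a short \<open>v\<close> whose state at \<open>j\<close> is that of \<open>u\<close>
          at \<open>i\<close>.\<close>
        have "foldl \<epsilon> r0 (take i (convolution [u, y])) \<in>
            (\<lambda>u. foldl \<epsilon> r0 (take j (convolution [u, y]))) ` {u \<in> D. length u \<le> m}"
          using ij(4) u unfolding st_def by blast
        then obtain v where v: "v \<in> D" "length v \<le> m"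
          "foldl \<epsilon> r0 (take i (convolution [u, y])) = foldl \<epsilon> r0 (take j (convolution [v, y]))"
          by blast
        \<comment> \<open>Both \<open>u\<close> and \<open>v\<close> end before \<open>j\<close>, so
          from there on the columns show only \<open>y\<close>.\<close>
        have "drop j (convolution [u, y]) = drop j (convolution [v, y])"
        proof (rule drop_convolution_eq)
          show "length (convolution [u, y]) - j = length (convolution [v, y]) - j"
            using u v ij by (simp add: length_convolution max_def)
        qed (use u v ij in auto)
        with v(3) have "foldl \<epsilon> r0 (cut i j (convolution [u, y])) = foldl \<epsilon> r0 (convolution [v, y])"
          by (rule foldl_cut)
        moreover have "convolution [u, cut i j y] = cut i j (convolution [u, y])"
          using convolution_cut[of i j "[u, y]"] ij u by (simp add: cut_short)
        moreover have "foldl \<epsilon> r0 (convolution [u, cut i j y]) \<in> Acc'"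
          using uT R(3) yL DL u cut_in_lists by (subst (asm) R(3)) simp_all
        ultimately have "[v, y] \<in> T"
          using yL DL v by (subst R(3)) simp_all
        then show False using g(3) v by blast
      qed
      ultimately have "good (cut i j x, cut i j s, cut i j y)"
        by (simp add: good_def)
      \<comment> \<open>Only \<open>x\<close> is known to reach beyond \<open>j\<close>;
        \<open>s\<close> and \<open>y\<close> do not grow, which suffices for the total
        length.\<close>
      from least[OF this] show False
        using length_cut_less[OF ij(2), of x] length_cut_le[of i j s] length_cut_le[of i j y] ij long
        by auto
    qed
    then show "\<exists>x\<in>D. \<exists>s\<in>D. \<exists>y\<in>D. length x \<le> m + card ?B \<and>
        P \<alpha> x s \<and> P x y s \<and> (\<forall>u\<in>D. length u \<le> m \<longrightarrow> \<not> E u y)"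
      using g Ds by (intro bexI[of _ x] bexI[of _ s] bexI[of _ y]) (auto simp: S T)
  qed
qed


text \<open>All that is used of word automaticity. An infinite set of conjugates leaves every finite
  ball, and pumping then bounds the conjugating element with a constant \<open>C\<close> that does
  not depend on \<open>m\<close>.\<close>

theorem word_automatic_growth:
  fixes G :: "('g, 'm) monoid_scheme" (structure)
  assumes "word_automatic G" "group G"
  shows "\<exists>(B :: nat \<Rightarrow> 'g set) c s. (\<forall>m. finite (B m) \<and> card (B m) \<le> s ^ m) \<and>
    mono B \<and> (\<Union>m. B m) = carrier G \<and>
    (\<forall>m. \<forall>x\<in>B m. \<forall>y\<in>B m. x \<otimes> y \<in> B (m + c)) \<and>
    (\<forall>a\<in>carrier G. infinite ((\<lambda>x. inv x \<otimes> a \<otimes> x) ` carrier G) \<longrightarrow>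
      (\<exists>C m0. \<forall>m\<ge>m0. \<exists>x\<in>B (m + C). inv x \<otimes> a \<otimes> x \<notin> B m))"
proof -
  interpret group G by fact
  obtain \<Sigma> :: "nat set" and D \<pi> where \<Sigma>: "finite \<Sigma>" "regular_language \<Sigma> D" and
      \<pi>: "\<pi> ` D = carrier G" and
      E: "FA_recognizable \<Sigma> 2 {[\<sigma>, \<tau>] | \<sigma> \<tau>. \<sigma> \<in> D \<and> \<tau> \<in> D \<and> \<pi> \<sigma> = \<pi> \<tau>}" and
      M: "FA_recognizable \<Sigma> 3 {[\<sigma>, \<tau>, \<rho>] | \<sigma> \<tau> \<rho>. \<sigma> \<in> D \<and> \<tau> \<in> D \<and> \<rho> \<in> D \<and>
                                  \<pi> \<sigma> \<otimes> \<pi> \<tau> = \<pi> \<rho>}"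
    using assms(1) unfolding word_automatic_def by blast
  have D: "D \<subseteq> lists \<Sigma>" using \<Sigma>(2) by (auto simp: regular_language_def)
  have \<pi>_closed: "\<pi> \<sigma> \<in> carrier G" if "\<sigma> \<in> D" for \<sigma> using \<pi> that by blast
  have rep: "\<exists>\<sigma>\<in>D. g = \<pi> \<sigma>" if "g \<in> carrier G" for g using \<pi> that by blast
  let ?B = "ball_of D \<pi>"
  obtain c where c: "\<And>\<sigma> \<tau> \<rho> m. \<sigma> \<in> D \<Longrightarrow> \<tau> \<in> D \<Longrightarrow> \<rho> \<in> D \<Longrightarrow> \<pi> \<sigma> \<otimes> \<pi> \<tau> = \<pi> \<rho> \<Longrightarrow>
      length \<sigma> \<le> m \<Longrightarrow> length \<tau> \<le> m \<Longrightarrow> \<exists>\<rho>'\<in>D. \<pi> \<sigma> \<otimes> \<pi> \<tau> = \<pi> \<rho>' \<and> length \<rho>' \<le> m + c"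
    using FA_product_length[OF M HOL.refl] by meson
  have mult: "x \<otimes> y \<in> ?B (m + c)" if xy: "x \<in> ?B m" "y \<in> ?B m" for x y m
  proof -
    obtain \<sigma> \<tau> where st: "\<sigma> \<in> D" "\<tau> \<in> D" "x = \<pi> \<sigma>" "y = \<pi> \<tau>" "length \<sigma> \<le> m" "length \<tau> \<le> m"
      using xy by (auto simp: ball_of_def)
    then obtain \<rho> where "\<rho> \<in> D" "\<pi> \<sigma> \<otimes> \<pi> \<tau> = \<pi> \<rho>"
      using rep[of "\<pi> \<sigma> \<otimes> \<pi> \<tau>"] \<pi>_closed by auto
    then show ?thesis using c[of \<sigma> \<tau> \<rho> m] st by (auto simp: ball_of_def)
  qed
  have escape: "\<exists>C m0. \<forall>m\<ge>m0. \<exists>x\<in>?B (m + C). inv x \<otimes> a \<otimes> x \<notin> ?B m"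
    if a: "a \<in> carrier G" and inf: "infinite ((\<lambda>x. inv x \<otimes> a \<otimes> x) ` carrier G)" for a
  proof -
    obtain \<alpha> where \<alpha>: "\<alpha> \<in> D" "a = \<pi> \<alpha>" using rep a by blast
    have conj: "inv x \<otimes> a \<otimes> x = y \<longleftrightarrow> a \<otimes> x = x \<otimes> y"
      if "x \<in> carrier G" "y \<in> carrier G" for x y
      using that a by (metis inv_solve_left m_assoc m_closed inv_closed)
    \<comment> \<open>The conjugate \<open>y\<close> of \<open>a\<close> by \<open>x\<close> is
      expressed by \<open>a x = s = x y\<close>, which involves multiplication alone and no
      inverse.\<close>
    define new where "new m x s y \<longleftrightarrow> \<pi> \<alpha> \<otimes> \<pi> x = \<pi> s \<and> \<pi> x \<otimes> \<pi> y = \<pi> s \<and>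
      (\<forall>u\<in>D. length u \<le> m \<longrightarrow> \<pi> u \<noteq> \<pi> y)" for m x s y
    obtain C where C: "\<forall>m\<ge>length \<alpha>. \<forall>x\<in>D. \<forall>s\<in>D. \<forall>y\<in>D. new m x s y \<longrightarrow>
        (\<exists>x\<in>D. \<exists>s\<in>D. \<exists>y\<in>D. length x \<le> m + C \<and> new m x s y)"
      using FA_escape[OF M HOL.refl E HOL.refl D \<alpha>(1)] unfolding new_def by (rule exE)
    have "\<exists>x\<in>?B (m + C). inv x \<otimes> a \<otimes> x \<notin> ?B m" if m: "length \<alpha> \<le> m" for m
    proof -
      have "\<not> (\<lambda>x. inv x \<otimes> a \<otimes> x) ` carrier G \<subseteq> ?B m"
        using inf card_ball_of(1)[OF \<Sigma>(1) D] finite_subset by blast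
      then obtain g where g: "g \<in> carrier G" "inv g \<otimes> a \<otimes> g \<notin> ?B m" by blast
      obtain x s y where g': "x \<in> D" "s \<in> D" "y \<in> D"
        "g = \<pi> x" "a \<otimes> g = \<pi> s" "inv g \<otimes> a \<otimes> g = \<pi> y"
        using rep[of g] rep[of "a \<otimes> g"] rep[of "inv g \<otimes> a \<otimes> g"] g(1) a by auto
      have "\<pi> x \<otimes> \<pi> y = \<pi> s"
        using g' conj[of g "\<pi> y"] g(1) \<pi>_closed by auto
      moreover have "\<pi> u \<noteq> \<pi> y" if "u \<in> D" "length u \<le> m" for u
      proof -
        have "\<pi> u \<in> ?B m" using that by (simp add: ball_of_def)
        then show ?thesis using g(2) g'(6) by auto
      qed
      ultimately have "new m x s y" using g' \<alpha>(2) by (simp add: new_def)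
      then obtain x s y where x: "x \<in> D" "y \<in> D" "length x \<le> m + C" "new m x s y"
        using C m g'(1-3) by blast
      then have "\<pi> y \<notin> ?B m" by (force simp: new_def ball_of_def)
      moreover have "inv \<pi> x \<otimes> a \<otimes> \<pi> x = \<pi> y"
        using conj[of "\<pi> x" "\<pi> y"] x \<pi>_closed \<alpha>(2) by (simp add: new_def)
      moreover have "\<pi> x \<in> ?B (m + C)" using x by (simp add: ball_of_def)
      ultimately show ?thesis
        by metis
    qed
    then show ?thesis by blast
  qed
  have "mono ?B" by (simp add: mono_def mono_ball_of)
  moreover have "(\<Union>m. ?B m) = carrier G"
  proof
    show "carrier G \<subseteq> (\<Union>m. ?B m)"
    proof
      fix g assume "g \<in> carrier G"
      then obtain \<sigma> where "\<sigma> \<in> D" "g = \<pi> \<sigma>" using rep by blast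
      then have "g \<in> ?B (length \<sigma>)" by (simp add: ball_of_def)
      then show "g \<in> (\<Union>m. ?B m)" by blast
    qed
  qed (use \<pi>_closed in \<open>auto simp: ball_of_def\<close>)
  ultimately show ?thesis
    by (intro exI[of _ ?B] exI[of _ c] exI[of _ "card \<Sigma> + 1"] conjI allI ballI impI
        mult escape card_ball_of[OF \<Sigma>(1) D])
qed

section \<open>Invariants of words and the commutator form\<close>

definition letter_exp :: "nat \<Rightarrow> nat \<times> bool \<Rightarrow> int" where
  "letter_exp i l = (if fst l = i then if snd l then 1 else - 1 else 0)"

text \<open>The exponent sum of the generator with index \<open>i\<close>; modulo \<open>p\<close>
  it is a coordinate of the abelianisation.\<close>

definition cnt :: "nat \<Rightarrow> gword \<Rightarrow> int" where
  "cnt i w = (\<Sum>l\<leftarrow>w. letter_exp i l)"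

lemma cnt_simps [simp]:
  "cnt i [] = 0" "cnt i (l # w) = letter_exp i l + cnt i w" "cnt i (u @ v) = cnt i u + cnt i v"
  by (simp_all add: cnt_def)

text \<open>The Magnus coefficient of \<open>X\<^sub>i X\<^sub>j\<close>. For \<open>i = j\<close> it is not invariant under free cancellation.\<close>
fun area :: "nat \<Rightarrow> nat \<Rightarrow> gword \<Rightarrow> int" where
  "area i j [] = 0"
| "area i j (l # w) = area i j w + letter_exp i l * cnt j w"

lemma area_append: "area i j (u @ v) = area i j u + area i j v + cnt i u * cnt j v"
  by (induction u) (auto simp: algebra_simps)

lemma cnt_winv [simp]: "cnt i (winv u) = - cnt i u"
  by (induction u) (auto simp: winv_Nil winv_Cons letter_exp_def)

lemma cnt_wcomm [simp]: "cnt i (wcomm u v) = 0"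
  by (simp add: wcomm_def)

lemma cnt_power [simp]: "cnt i (concat (replicate n u)) = int n * cnt i u"
  by (induction n) (auto simp: algebra_simps)

lemma area_winv: "i \<noteq> j \<Longrightarrow> area i j (winv u) = cnt i u * cnt j u - area i j u"
  by (induction u) (auto simp: winv_Nil winv_Cons letter_exp_def area_append algebra_simps)

lemma area_wcomm:
  "i \<noteq> j \<Longrightarrow> area i j (wcomm u v) = cnt i u * cnt j v - cnt i v * cnt j u"
  by (simp add: wcomm_def area_append area_winv algebra_simps)

text \<open>Doubled, so that the binomial coefficient from expanding the power needs no
  division.\<close>

lemma area_power:
  "2 * area i j (concat (replicate n u)) =
    int n * (2 * area i j u + (int n - 1) * (cnt i u * cnt j u))"
  by (induction n) (auto simp: area_append algebra_simps)

lemma cnt_cong: "N2_eq p u v \<Longrightarrow> [cnt i u = cnt i v] (mod int p)"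
proof (induction rule: N2_eq.induct)
  case (append u u' v v')
  then show ?case by (simp add: cong_add)
qed (auto simp: letter_exp_def cong_sym cong_0_iff intro: cong_trans)

text \<open>By the product rule \<open>area_append\<close>, compatibility with concatenation rests
  on the invariance of \<open>cnt\<close>. In the nilpotency law the inner commutator has exponent
  sums 0; in the exponent law the coefficient p (p - 1) / 2 is a multiple of the odd
  \<open>p\<close>.\<close>

lemma area_cong:
  assumes "odd p" "i \<noteq> j"
  shows "N2_eq p u v \<Longrightarrow> [area i j u = area i j v] (mod int p)"
proof (induction rule: N2_eq.induct)
  case (append u u' v v')
  then show ?case by (auto simp: area_append intro!: cong_add cong_mult cnt_cong)
next
  case (exponent u)
  have "coprime (int p) 2" using assms by simp
  moreover have "int p dvd 2 * area i j (concat (replicate p u))"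
    unfolding area_power by simp
  ultimately show ?case by (simp add: cong_0_iff coprime_dvd_mult_right_iff)
qed (use assms in \<open>auto simp: letter_exp_def cong_sym area_wcomm intro: cong_trans\<close>)

section \<open>Commutators in nilpotent groups of class two\<close>

lemma (in group) commutator_closed:
  "x \<in> carrier G \<Longrightarrow> y \<in> carrier G \<Longrightarrow> commutator G x y \<in> carrier G"
  by (simp add: commutator_def)

lemma (in group) commutator_eq_one_iff:
  assumes "x \<in> carrier G" "y \<in> carrier G"
  shows "commutator G x y = \<one> \<longleftrightarrow> x \<otimes> y = y \<otimes> x"
proof -
  have "commutator G x y = inv (y \<otimes> x) \<otimes> (x \<otimes> y)"
    using assms by (simp add: commutator_def inv_mult_group m_assoc)
  moreover have "y \<otimes> x \<in> carrier G" "x \<otimes> y \<in> carrier G" using assms by auto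
  ultimately show ?thesis
    by (metis inv_closed inv_solve_left' inv_solve_left r_one l_inv one_closed)
qed

lemma commutator_central:
  assumes "in_N2 p G" "x \<in> carrier G" "y \<in> carrier G" "z \<in> carrier G"
  shows "commutator G x y \<otimes>\<^bsub>G\<^esub> z = z \<otimes>\<^bsub>G\<^esub> commutator G x y"
proof -
  interpret group G using assms by (simp add: in_N2_def)
  show ?thesis
    using assms by (simp add: in_N2_def commutator_closed flip: commutator_eq_one_iff)
qed

text \<open>In every group [x, yz] is [x, z] times the conjugate of [x, y] by \<open>z\<close>;
  centrality removes the conjugation and the order. Hence commutation with \<open>x\<close> is a
  homomorphism.\<close>

lemma commutator_mult_right:
  assumes "in_N2 p G" "x \<in> carrier G" "y \<in> carrier G" "z \<in> carrier G"
  shows "commutator G x (y \<otimes>\<^bsub>G\<^esub> z) = commutator G x y \<otimes>\<^bsub>G\<^esub> commutator G x z"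
proof -
  interpret group G using assms by (simp add: in_N2_def)
  note [simp] = assms(2-4)
  have "commutator G x (y \<otimes>\<^bsub>G\<^esub> z) = inv\<^bsub>G\<^esub> x \<otimes>\<^bsub>G\<^esub> (inv\<^bsub>G\<^esub> z \<otimes>\<^bsub>G\<^esub> (x \<otimes>\<^bsub>G\<^esub> (commutator G x y \<otimes>\<^bsub>G\<^esub> z)))"
    by (simp add: commutator_def inv_mult_group m_assoc inv_solve_left)
       (simp add: m_assoc[symmetric])
  also have "commutator G x y \<otimes>\<^bsub>G\<^esub> z = z \<otimes>\<^bsub>G\<^esub> commutator G x y"
    using assms by (rule commutator_central)
  also have "inv\<^bsub>G\<^esub> x \<otimes>\<^bsub>G\<^esub> (inv\<^bsub>G\<^esub> z \<otimes>\<^bsub>G\<^esub> (x \<otimes>\<^bsub>G\<^esub> (z \<otimes>\<^bsub>G\<^esub> commutator G x y))) =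
      commutator G x z \<otimes>\<^bsub>G\<^esub> commutator G x y"
    unfolding commutator_def[of G x z] by (simp add: m_assoc commutator_closed)
  also have "\<dots> = commutator G x y \<otimes>\<^bsub>G\<^esub> commutator G x z"
    using assms by (intro commutator_central) (auto simp: commutator_closed)
  finally show ?thesis .
qed

section \<open>Echelon sequences\<close>

text \<open>Row echelon form of the exponent vectors over the field with \<open>p\<close> elements:
  \<open>q\<close> is the pivot of \<open>x\<close>, and only the later words must vanish there. A
  word can thus be appended once it is reduced at all earlier pivots.\<close>

fun echelon :: "nat \<Rightarrow> gword list \<Rightarrow> nat list \<Rightarrow> bool" where
  "echelon p [] [] \<longleftrightarrow> True"
| "echelon p (x # xs) (q # qs) \<longleftrightarrow>
     \<not> int p dvd cnt q x \<and> (\<forall>y\<in>set xs. int p dvd cnt q y) \<and> echelon p xs qs"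
| "echelon p _ _ \<longleftrightarrow> False"

fun power_prod :: "gword list \<Rightarrow> nat list \<Rightarrow> gword" where
  "power_prod (x # xs) (e # es) = concat (replicate e x) @ power_prod xs es"
| "power_prod _ _ = []"

definition exps :: "nat \<Rightarrow> nat \<Rightarrow> nat list set" where
  "exps p n = {es. set es \<subseteq> {..<p} \<and> length es = n}"

lemma card_exps: "card (exps p n) = p ^ n"
  using card_lists_length_eq[of "{..<p}" n] by (simp add: exps_def)

lemma exps_Cons: "e # es \<in> exps p (Suc n) \<longleftrightarrow> e < p \<and> es \<in> exps p n"
  by (auto simp: exps_def)

lemma cnt_power_prod_dvd:
  "\<forall>y\<in>set xs. int p dvd cnt q y \<Longrightarrow> int p dvd cnt q (power_prod xs es)"
  by (induction xs es rule: power_prod.induct) auto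

text \<open>At the first pivot only the first word contributes, which determines its exponent modulo
  \<open>p\<close>; cancelling it leaves the same situation for the remaining words.\<close>

lemma power_prod_inj:
  assumes "prime p" "echelon p xs qs" "es \<in> exps p (length xs)" "es' \<in> exps p (length xs)"
    "\<forall>q\<in>set qs. [cnt q (power_prod xs es) = cnt q (power_prod xs es')] (mod int p)"
  shows "es = es'"
  using assms
proof (induction p xs qs arbitrary: es es' rule: echelon.induct)
  case (2 p x xs q qs)
  obtain e fs where es: "es = e # fs" using 2 by (cases es) (auto simp: exps_def)
  obtain e' fs' where es': "es' = e' # fs'" using 2 by (cases es') (auto simp: exps_def)
  have vanish: "int p dvd cnt q (power_prod xs gs)" for gs
    using "2.prems"(2) by (intro cnt_power_prod_dvd) simp
  have "[int e * cnt q x = int e' * cnt q x] (mod int p)"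
  proof -
    have "int p dvd (int e * cnt q x + cnt q (power_prod xs fs)) -
        (int e' * cnt q x + cnt q (power_prod xs fs'))"
      using "2.prems"(5) by (simp add: es es' cong_iff_dvd_diff)
    moreover have "int p dvd cnt q (power_prod xs fs') - cnt q (power_prod xs fs)"
      using vanish by simp
    ultimately show ?thesis
      unfolding cong_iff_dvd_diff by (drule_tac dvd_add) (assumption, simp)
  qed
  moreover have "coprime (cnt q x) (int p)"
    using "2.prems"(2,1) by (metis coprime_commute echelon.simps(2) prime_imp_coprime prime_nat_int_transfer)
  ultimately have "[e = e'] (mod p)"
    by (simp add: cong_mult_rcancel cong_int_iff)
  then have e: "e = e'"
    using "2.prems"(3,4) by (auto simp: es es' exps_Cons intro: cong_less_modulus_unique_nat)
  have "fs = fs'"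
    using 2 by (intro "2.IH") (auto simp: es es' e exps_Cons cong_add_lcancel)
  then show ?case by (simp add: es es' e)
qed (auto simp: exps_def)

text \<open>Gaussian elimination from the first pivot on; later words vanish at earlier pivots and
  do not spoil what has been cleared.\<close>

lemma echelon_reduce:
  assumes "prime p" "echelon p xs qs"
  shows "\<exists>es\<in>exps p (length xs). \<forall>q\<in>set qs. int p dvd cnt q (x @ power_prod xs es)"
  using assms
proof (induction p xs qs arbitrary: x rule: echelon.induct)
  case (1 p)
  then show ?case by (auto simp: exps_def)
next
  case (2 p y xs q qs)
  have p: "p > 0" using "2.prems"(1) by (simp add: prime_gt_0_nat)
  have "coprime (cnt q y) (int p)"
    using "2.prems"(2,1) by (metis coprime_commute echelon.simps(2) prime_imp_coprime prime_nat_int_transfer)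
  then obtain c where c: "[cnt q y * c = 1] (mod int p)"
    using cong_solve_coprime_int by blast
  \<comment> \<open>The residue of - \<open>cnt q x\<close> / \<open>cnt q y\<close>, which clears
    the pivot \<open>q\<close>.\<close>
  define e where "e = nat ((- cnt q x * c) mod int p)"
  have e: "e < p" "int e = (- cnt q x * c) mod int p"
    using p by (auto simp: e_def nat_less_iff)
  have "[cnt q x + int e * cnt q y = cnt q x + (- cnt q x * c) * cnt q y] (mod int p)"
    unfolding e(2) by (intro cong_add cong_mult) (auto simp: cong_def)
  also have "cnt q x + (- cnt q x * c) * cnt q y = cnt q x - cnt q x * (cnt q y * c)"
    by simp
  also have "[cnt q x - cnt q x * (cnt q y * c) = cnt q x - cnt q x * 1] (mod int p)"
    by (intro cong_diff cong_mult c) auto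
  finally have 0: "int p dvd cnt q x + int e * cnt q y" by (simp add: cong_0_iff)
  obtain es where es: "es \<in> exps p (length xs)"
    "\<forall>q\<in>set qs. int p dvd cnt q ((x @ concat (replicate e y)) @ power_prod xs es)"
    using "2.IH"[of "x @ concat (replicate e y)"] "2.prems" by auto
  have "int p dvd cnt q (power_prod xs es)"
    using "2.prems"(2) by (intro cnt_power_prod_dvd) simp
  then have "int p dvd (cnt q x + int e * cnt q y) + cnt q (power_prod xs es)"
    using 0 by (rule dvd_add[rotated])
  then show ?case
    using es e by (intro bexI[of _ "e # es"]) (auto simp: exps_Cons add.assoc)
qed auto

lemma echelon_snoc:
  assumes "echelon p xs qs" "\<forall>q\<in>set qs. int p dvd cnt q x" "\<not> int p dvd cnt q x"
  shows "echelon p (xs @ [x]) (qs @ [q])"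
  using assms by (induction p xs qs rule: echelon.induct) auto

lemma power_prod_snoc:
  "length es = length xs \<Longrightarrow>
    power_prod (xs @ [x]) (es @ [e]) = power_prod xs es @ concat (replicate e x)"
  by (induction es xs rule: list_induct2) auto

section \<open>Counting products of commutators\<close>

text \<open>By bilinearity each factor is a product of powers of the commutators of \<open>x\<close>
  with all later words. Collecting them in one commutator leaves only as many factors as there are
  words, so the length stays linear while all exponents occur.\<close>

fun comm_prods :: "nat \<Rightarrow> gword list \<Rightarrow> gword set" where
  "comm_prods p [] = {[]}"
| "comm_prods p (x # xs) =
     (\<lambda>(es, c). wcomm x (power_prod xs es) @ c) ` (exps p (length xs) \<times> comm_prods p xs)"

text \<open>By \<open>area_wcomm\<close> both terms contain the exponent sum at \<open>i\<close> of
  one of the two entries.\<close>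

lemma area_comm_prods:
  assumes "i \<noteq> j" "\<forall>y\<in>set xs. int p dvd cnt i y" "c \<in> comm_prods p xs"
  shows "int p dvd area i j c"
  using assms(2-)
proof (induction xs arbitrary: c)
  case (Cons x xs)
  then obtain es c' where c: "c = wcomm x (power_prod xs es) @ c'" "c' \<in> comm_prods p xs"
    by auto
  then have "int p dvd area i j c'" using Cons by simp
  moreover have "int p dvd cnt i (power_prod xs es)"
    using Cons by (intro cnt_power_prod_dvd) simp
  ultimately show ?case
    using Cons(2) assms(1) by (simp add: c area_append area_wcomm)
qed simp

lemma N2_eq_append_cancel: "N2_eq p (u @ v) (u @ w) \<Longrightarrow> N2_eq p v w"
proof -
  interpret group "F_infinity p" by (rule group_F_infinity)
  show "N2_eq p (u @ v) (u @ w) \<Longrightarrow> N2_eq p v w"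
    by (metis (no_types) F_carrier F_mult N2_class_eq_iff rangeI monoid.Units_l_cancel group.Units_eq group.is_monoid group_F_infinity)
qed

text \<open>Let \<open>q\<close> be the pivot of the first word \<open>x\<close>. For other pivots
  \<open>r\<close>, \<open>area q r\<close> kills the commutators among the later words and reads
  off \<open>cnt q x\<close> times the exponent sum at \<open>r\<close> of the partner of
  \<open>x\<close>. This determines the exponents \<open>es\<close>; the first factor is then
  cancelled.\<close>

lemma card_comm_prods:
  assumes "prime p" "odd p" "echelon p xs qs"
  shows "p ^ (\<Sum>i<length xs. i) \<le> card (N2_class p ` comm_prods p xs)"
  using assms(3)
proof (induction xs arbitrary: qs)
  case (Cons x xs)
  obtain q qs' where qs: "qs = q # qs'" using Cons(2) by (cases qs) auto
  have ech: "\<not> int p dvd cnt q x" "\<forall>y\<in>set xs. int p dvd cnt q y" "echelon p xs qs'"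
    using Cons(2) by (auto simp: qs)
  have cop: "coprime (cnt q x) (int p)"
    using ech assms(1) by (metis coprime_commute prime_imp_coprime prime_nat_int_transfer)
  have step: "es = es' \<and> N2_eq p c c'"
    if es: "es \<in> exps p (length xs)" "es' \<in> exps p (length xs)"
    and c: "c \<in> comm_prods p xs" "c' \<in> comm_prods p xs"
    and eq: "N2_eq p (wcomm x (power_prod xs es) @ c) (wcomm x (power_prod xs es') @ c')"
    for es es' c c'
  proof -
    \<comment> \<open>The form \<open>area q r\<close> is an invariant only for distinct indices; at
      \<open>r = q\<close> both sides vanish modulo \<open>p\<close>.\<close>
    have "[cnt r (power_prod xs es) = cnt r (power_prod xs es')] (mod int p)"
      if "r \<in> set qs'" for r
    proof (cases "r = q")
      case True
      then show ?thesis
        using ech cnt_power_prod_dvd[of xs p q] by (metis cong_0_iff cong_sym cong_trans)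
    next
      case False
      have red: "[area q r (wcomm x (power_prod xs fs) @ d) = cnt q x * cnt r (power_prod xs fs)] (mod int p)"
        if "d \<in> comm_prods p xs" for fs d
      proof -
        have "int p dvd area q r d" "int p dvd cnt q (power_prod xs fs)"
          using False ech that by (auto intro: area_comm_prods cnt_power_prod_dvd)
        then show ?thesis
          using False by (simp add: area_append area_wcomm cong_iff_dvd_diff)
      qed
      have "[cnt q x * cnt r (power_prod xs es) = cnt q x * cnt r (power_prod xs es')] (mod int p)"
        using red[OF c(1)] red[OF c(2)] area_cong[OF assms(2) _ eq] False
        by (metis cong_sym cong_trans)
      then show ?thesis using cop by (simp add: cong_mult_lcancel)
    qed
    then have "es = es'" using power_prod_inj[OF assms(1) ech(3) es] by blast
    then show ?thesis using eq N2_eq_append_cancel by blast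
  qed
  \<comment> \<open>The tail is taken as a class, since \<open>step\<close> recovers it only up to
    \<open>N2_eq\<close>.\<close>
  define g where "g = (\<lambda>(es, K). N2_class p (wcomm x (power_prod xs es)) \<otimes>\<^bsub>F_infinity p\<^esub> K)"
  let ?A = "exps p (length xs) \<times> N2_class p ` comm_prods p xs"
  have "inj_on g ?A"
    by (auto simp: inj_on_def g_def F_mult N2_class_eq_iff dest: step)
  moreover have "g ` ?A = N2_class p ` comm_prods p (x # xs)"
  proof -
    have "?A = (\<lambda>(es, c). (es, N2_class p c)) ` (exps p (length xs) \<times> comm_prods p xs)"
      by auto
    then show ?thesis by (simp add: g_def F_mult image_image case_prod_beta')
  qed
  ultimately have "card (N2_class p ` comm_prods p (x # xs)) = card ?A"
    by (metis card_image)
  also have "\<dots> = p ^ length xs * card (N2_class p ` comm_prods p xs)"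
    by (simp add: card_cartesian_product card_exps)
  finally show ?case using Cons.IH[OF ech(3)] by (simp add: power_add mult.commute)
qed simp

section \<open>Commutation with a fixed element\<close>

lemma commutator_class_append:
  assumes "a \<in> carrier (F_infinity p)"
  shows "commutator (F_infinity p) a (N2_class p (u @ v)) =
    commutator (F_infinity p) a (N2_class p u) \<otimes>\<^bsub>F_infinity p\<^esub>
    commutator (F_infinity p) a (N2_class p v)"
  using commutator_mult_right[OF F_infinity_in_N2[of p] assms, of "N2_class p u" "N2_class p v"]
  by (simp add: F_mult F_carrier)

text \<open>Commutation with \<open>a\<close> is a homomorphism with central values of order
  dividing \<open>p\<close>, so its value at a word depends only on the exponent sums modulo
  \<open>p\<close>.\<close>

lemma commutator_class_eq_one:
  assumes a: "a \<in> carrier (F_infinity p)" and w: "\<And>i. int p dvd cnt i w"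
  shows "commutator (F_infinity p) a (N2_class p w) = \<one>\<^bsub>F_infinity p\<^esub>"
proof -
  interpret group "F_infinity p" by (rule group_F_infinity)
  define \<kappa> where "\<kappa> u = commutator (F_infinity p) a (N2_class p u)" for u
  have closed: "\<kappa> u \<in> carrier (F_infinity p)" for u
    unfolding \<kappa>_def using a by (rule commutator_closed) (simp add: F_carrier)
  have append: "\<kappa> (u @ v) = \<kappa> u \<otimes>\<^bsub>F_infinity p\<^esub> \<kappa> v" for u v
    unfolding \<kappa>_def using a by (rule commutator_class_append)
  have comm: "\<kappa> u \<otimes>\<^bsub>F_infinity p\<^esub> g = g \<otimes>\<^bsub>F_infinity p\<^esub> \<kappa> u"
    if "g \<in> carrier (F_infinity p)" for u g
    unfolding \<kappa>_def using F_infinity_in_N2 a _ that by (rule commutator_central) (simp add: F_carrier)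
  have nil: "\<kappa> [] = \<one>\<^bsub>F_infinity p\<^esub>"
    using append[of "[]" "[]"] closed by simp
  have cons: "\<kappa> (l # u) = \<kappa> [l] \<otimes>\<^bsub>F_infinity p\<^esub> \<kappa> u" for l u
    using append[of "[l]" u] by simp
  \<comment> \<open>Since the values of \<open>\<kappa>\<close> commute, the letters with property
    \<open>P\<close> can be moved to the front.\<close>
  have filt: "\<kappa> u = \<kappa> (filter P u) \<otimes>\<^bsub>F_infinity p\<^esub> \<kappa> (filter (\<lambda>l. \<not> P l) u)" for P u
  proof (induction u)
    case (Cons l u)
    show ?case
    proof (cases "P l")
      case True
      then show ?thesis
        using Cons closed by (simp add: cons[of l u] cons[of l "filter P u"] m_assoc)
    next
      case False
      have "\<kappa> (l # u) = (\<kappa> [l] \<otimes>\<^bsub>F_infinity p\<^esub> \<kappa> (filter P u)) \<otimes>\<^bsub>F_infinity p\<^esub> \<kappa> (filter (\<lambda>l. \<not> P l) u)"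
        using Cons closed by (simp add: cons[of l u] m_assoc)
      also have "\<kappa> [l] \<otimes>\<^bsub>F_infinity p\<^esub> \<kappa> (filter P u) = \<kappa> (filter P u) \<otimes>\<^bsub>F_infinity p\<^esub> \<kappa> [l]"
        using closed by (rule comm)
      finally show ?thesis
        using False closed by (simp add: cons[of l "filter (\<lambda>l. \<not> P l) u"] m_assoc)
    qed
  qed (simp add: nil)
  have inv: "\<kappa> [(n, False)] = inv\<^bsub>F_infinity p\<^esub> \<kappa> [(n, True)]" for n
  proof -
    have "N2_class p ([(n, False)] @ [(n, True)]) = N2_class p []"
      using N2_eq.cancel[of p n False] by (simp add: N2_class_eq_iff)
    then have "\<kappa> ([(n, False)] @ [(n, True)]) = \<one>\<^bsub>F_infinity p\<^esub>"
      using nil by (simp add: \<kappa>_def)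
    then show ?thesis using closed by (metis append inv_equality)
  qed
  have single: "\<kappa> u = \<kappa> [(n, True)] [^]\<^bsub>F_infinity p\<^esub> cnt n u" if "\<forall>l\<in>set u. fst l = n" for u n
    using that
  proof (induction u)
    case (Cons l u)
    have "\<kappa> [l] = \<kappa> [(n, True)] [^]\<^bsub>F_infinity p\<^esub> letter_exp n l"
      using Cons(2) closed inv by (cases l; cases "snd l") (auto simp: letter_exp_def int_pow_1 int_pow_neg)
    then show ?case using Cons closed by (simp add: cons[of l u] int_pow_mult)
  qed (simp add: nil)
  have "\<kappa> w = \<one>\<^bsub>F_infinity p\<^esub>" using w
  \<comment> \<open>All letters with the index of the first letter are split off at once: their
    exponent sum is a multiple of \<open>p\<close>, and the rest is shorter.\<close>
  proof (induction "length w" arbitrary: w rule: less_induct)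
    case less
    show ?case
    proof (cases w)
      case (Cons l v)
      let ?n = "fst l"
      let ?u = "filter (\<lambda>l. fst l = ?n) w" and ?v = "filter (\<lambda>l. fst l \<noteq> ?n) w"
      have cu: "cnt ?n (filter (\<lambda>l. fst l = ?n) w) = cnt ?n w" for w
        by (induction w) (auto simp: letter_exp_def)
      have cv: "cnt i (filter (\<lambda>l. fst l \<noteq> ?n) w) = (if i = ?n then 0 else cnt i w)" for i w
        by (induction w) (auto simp: letter_exp_def)
      obtain k where k: "cnt ?n w = int p * k" using less(2) by (auto simp: dvd_def)
      have pow: "\<kappa> [(?n, True)] [^]\<^bsub>F_infinity p\<^esub> p = \<one>\<^bsub>F_infinity p\<^esub>"
        using F_infinity_in_N2[of p] closed by (simp add: in_N2_def)
      have "\<kappa> ?u = \<kappa> [(?n, True)] [^]\<^bsub>F_infinity p\<^esub> (int p * k)"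
        using single[of ?u ?n] by (simp add: cu k)
      also have "\<dots> = (\<kappa> [(?n, True)] [^]\<^bsub>F_infinity p\<^esub> int p) [^]\<^bsub>F_infinity p\<^esub> k"
        using closed by (simp add: int_pow_pow)
      also have "\<dots> = \<one>\<^bsub>F_infinity p\<^esub>"
        using pow by (simp add: int_pow_int)
      finally have u: "\<kappa> ?u = \<one>\<^bsub>F_infinity p\<^esub>" .
      have "length ?v < length w"
        by (simp add: Cons le_imp_less_Suc)
      then have v: "\<kappa> ?v = \<one>\<^bsub>F_infinity p\<^esub>"
        by (rule less(1)) (simp add: cv less(2))
      show ?thesis using filt[of w "\<lambda>l. fst l = ?n"] u v by simp
    qed (simp add: nil)
  qed
  then show ?thesis by (simp add: \<kappa>_def)
qed

text \<open>An inverse becomes a positive power, so bounds on products also bound inverses.\<close>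

lemma N2_eq_winv_power:
  assumes "p > 0"
  shows "N2_eq p (concat (replicate (p - 1) u)) (winv u)"
proof -
  have "winv (winv u) = u" by (induction u) (auto simp: winv_def)
  then have "N2_eq p (u @ winv u) []" using N2_eq_winv_left[of p "winv u"] by simp
  moreover have "concat (replicate p u) = u @ concat (replicate (p - 1) u)"
    using assms by (cases p) auto
  ultimately show ?thesis
    by (metis N2_eq.exponent N2_eq.sym N2_eq.trans N2_eq_append_cancel)
qed

section \<open>Growth\<close>

text \<open>Here \<open>W m\<close> stands for the words whose class lies in the ball of radius
  \<open>m\<close>. A product costs the same \<open>c\<close> at every radius, so successive
  multiplications add up linearly; from \<open>n0\<close> on the estimates below hold.\<close>

locale word_growth =
  fixes p :: nat and W :: "nat \<Rightarrow> gword set" and c n0 :: nat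
  assumes prime: "prime p"
    and mono: "m \<le> n \<Longrightarrow> u \<in> W m \<Longrightarrow> u \<in> W n"
    and append: "u \<in> W m \<Longrightarrow> v \<in> W m \<Longrightarrow> u @ v \<in> W (m + c)"
    and N2_eq: "N2_eq p u v \<Longrightarrow> u \<in> W m \<Longrightarrow> v \<in> W m"
    and Nil: "[] \<in> W n0"
begin

lemma power: "u \<in> W m \<Longrightarrow> n0 \<le> m \<Longrightarrow> concat (replicate e u) \<in> W (m + e * c)"
proof (induction e)
  case 0
  then show ?case using Nil mono by auto
next
  case (Suc e)
  then have "u @ concat (replicate e u) \<in> W (m + e * c + c)"
    by (intro append) (auto intro: mono[of m])
  then show ?case by (simp add: ac_simps)
qed

lemma power_le: "u \<in> W m \<Longrightarrow> n0 \<le> m \<Longrightarrow> e \<le> p \<Longrightarrow> concat (replicate e u) \<in> W (m + p * c)"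
  using power[of u m e] mono[of "m + e * c" "m + p * c"] by simp

lemma winv: "u \<in> W m \<Longrightarrow> n0 \<le> m \<Longrightarrow> winv u \<in> W (m + p * c)"
  using power_le[of u m "p - 1"] N2_eq[OF N2_eq_winv_power] prime by (auto simp: prime_gt_0_nat)

lemma wcomm:
  assumes "u \<in> W m" "v \<in> W m" "n0 \<le> m"
  shows "wcomm u v \<in> W (m + p * c + 3 * c)"
proof -
  have "u \<in> W (m + p * c)" "v \<in> W (m + p * c)" using assms by (auto intro: mono[rotated])
  then have "winv u @ winv v \<in> W (m + p * c + c)" "u @ v \<in> W (m + p * c + c)"
    using assms by (auto intro: append winv)
  then have "(winv u @ winv v) @ (u @ v) \<in> W (m + p * c + c + c)" by (rule append)
  then show ?thesis by (auto simp: wcomm_def intro: mono[rotated])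
qed

text \<open>Every commutator has a radius bounded independently of the number of words, and each
  further factor costs one \<open>c\<close>.\<close>

lemma comm_prods:
  assumes "\<forall>es\<in>exps p (length xs). power_prod xs es \<in> W m" "n0 \<le> m"
  shows "comm_prods p xs \<subseteq> W (m + p * c + 3 * c + length xs * c)"
  using assms(1)
proof (induction xs)
  case Nil
  have "[] \<in> W (m + p * c + 3 * c + length [] * c)"
    by (rule mono[OF _ word_growth.Nil[OF word_growth_axioms]]) (use assms(2) in simp)
  then show ?case by simp
next
  case (Cons x xs)
  let ?m = "m + p * c + 3 * c + length xs * c"
  \<comment> \<open>Leading exponent 0 yields the power products of the tail; below, the exponents
    1, 0, ..., 0 single out \<open>x\<close>.\<close>
  have tail: "power_prod xs es \<in> W m" if "es \<in> exps p (length xs)" for es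
    using bspec[OF Cons(2), of "0 # es"] that prime by (simp add: exps_Cons prime_gt_0_nat)
  have zero: "power_prod ys (replicate (length ys) 0) = []" for ys
    by (induction ys) auto
  have "1 # replicate (length xs) 0 \<in> exps p (length (x # xs))"
    using prime_gt_1_nat[OF prime] by (auto simp: exps_def)
  from bspec[OF Cons(2) this] have x: "x \<in> W m" by (simp add: zero)
  show ?case
  proof
    fix w assume "w \<in> comm_prods p (x # xs)"
    then obtain es d where w: "w = wcomm x (power_prod xs es) @ d"
      "es \<in> exps p (length xs)" "d \<in> comm_prods p xs" by auto
    have "wcomm x (power_prod xs es) \<in> W ?m"
      using wcomm[OF x tail[OF w(2)] assms(2)] by (auto intro: mono[rotated])
    moreover have "d \<in> W ?m" using Cons.IH tail w(3) by auto
    ultimately have "w \<in> W (?m + c)" unfolding w(1) by (rule append)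
    then show "w \<in> W (m + p * c + 3 * c + length (x # xs) * c)" by (simp add: ac_simps)
  qed
qed

text \<open>A word that conjugates \<open>a\<close> far enough away cannot agree modulo the centre
  with a short power product of the words already chosen, so reducing it leaves a new pivot.\<close>

lemma echelon_extend:
  assumes a: "a \<in> W n0"
    and escape: "\<And>m. n0 \<le> m \<Longrightarrow> \<exists>x\<in>W (m + C). winv x @ a @ x \<notin> W m"
  shows "\<exists>xs qs. length xs = k \<and> echelon p xs qs \<and>
    (\<forall>es\<in>exps p k. power_prod xs es \<in> W (n0 + k * (C + 4 * c + 2 * p * c)))"
proof (induction k)
  case 0
  then show ?case using Nil by (intro exI[of _ "[]"]) (auto simp: exps_def)
next
  case (Suc k)
  define m where "m = n0 + k * (C + 4 * c + 2 * p * c)"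
  obtain xs qs where xs: "length xs = k" "echelon p xs qs"
    "\<And>es. es \<in> exps p k \<Longrightarrow> power_prod xs es \<in> W m"
    using Suc by (auto simp: m_def)
  \<comment> \<open>The radius that bounds the conjugate \<open>r @ a @ winv r\<close>:
    \<open>p * c\<close> for the inverse and two products.\<close>
  let ?m = "m + p * c + 2 * c"
  obtain x where x: "x \<in> W (?m + C)" "winv x @ a @ x \<notin> W ?m"
    using escape[of ?m] by (auto simp: m_def)
  obtain es where es: "es \<in> exps p k" "\<forall>q\<in>set qs. int p dvd cnt q (x @ power_prod xs es)"
    using echelon_reduce[OF prime xs(2)] xs(1) by blast
  define r where "r = power_prod xs es"
  have r: "r \<in> W m" using xs(3) es(1) by (simp add: r_def)
  define y where "y = x @ r"
  have y: "y \<in> W (?m + C + c)"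
    unfolding y_def using x(1) r by (intro append) (auto intro: mono[rotated])
  \<comment> \<open>Otherwise \<open>y = x @ r\<close> would commute with \<open>a\<close>, and the
    conjugate of \<open>a\<close> by \<open>x\<close> would be \<open>r @ a @ winv r\<close>, which
    lies in \<open>W ?m\<close>.\<close>
  have "\<exists>q. \<not> int p dvd cnt q y"
  proof (rule ccontr)
    assume "\<not> ?thesis"
    then have "commutator (F_infinity p) (N2_class p a) (N2_class p y) = \<one>\<^bsub>F_infinity p\<^esub>"
      by (intro commutator_class_eq_one) (auto simp: F_carrier)
    then have "N2_eq p (a @ x @ r) (x @ r @ a)"
      using group.commutator_eq_one_iff[OF group_F_infinity, of "N2_class p a" p "N2_class p y"]
      by (simp add: F_carrier F_mult y_def flip: N2_class_eq_iff)
    have "N2_class p (winv x @ a @ x) = N2_class p (r @ a @ winv r)"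
    proof -
      interpret group "F_infinity p" by (rule group_F_infinity)
      define X A R where "X = N2_class p x" and "A = N2_class p a" and "R = N2_class p r"
      have car: "X \<in> carrier (F_infinity p)" "A \<in> carrier (F_infinity p)" "R \<in> carrier (F_infinity p)"
        by (auto simp: X_def A_def R_def F_carrier)
      have "A \<otimes>\<^bsub>F_infinity p\<^esub> (X \<otimes>\<^bsub>F_infinity p\<^esub> R) = X \<otimes>\<^bsub>F_infinity p\<^esub> (R \<otimes>\<^bsub>F_infinity p\<^esub> A)"
        using \<open>N2_eq p (a @ x @ r) (x @ r @ a)\<close>
        by (simp add: X_def A_def R_def F_mult N2_class_eq_iff)
      then have "inv\<^bsub>F_infinity p\<^esub> X \<otimes>\<^bsub>F_infinity p\<^esub> (A \<otimes>\<^bsub>F_infinity p\<^esub> (X \<otimes>\<^bsub>F_infinity p\<^esub> R)) = R \<otimes>\<^bsub>F_infinity p\<^esub> A"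
        using car by (simp add: inv_solve_left')
      then have "inv\<^bsub>F_infinity p\<^esub> X \<otimes>\<^bsub>F_infinity p\<^esub> (A \<otimes>\<^bsub>F_infinity p\<^esub> X) =
          (R \<otimes>\<^bsub>F_infinity p\<^esub> A) \<otimes>\<^bsub>F_infinity p\<^esub> inv\<^bsub>F_infinity p\<^esub> R"
        using car by (intro inv_solve_right[THEN iffD2]) (simp_all add: m_assoc)
      then have "inv\<^bsub>F_infinity p\<^esub> X \<otimes>\<^bsub>F_infinity p\<^esub> (A \<otimes>\<^bsub>F_infinity p\<^esub> X) =
          R \<otimes>\<^bsub>F_infinity p\<^esub> (A \<otimes>\<^bsub>F_infinity p\<^esub> inv\<^bsub>F_infinity p\<^esub> R)"
        using car by (simp add: m_assoc)
      then show ?thesis by (simp add: X_def A_def R_def F_mult F_inv)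
    qed
    moreover have "r @ a @ winv r \<in> W ?m"
    proof -
      have "n0 \<le> m" by (simp add: m_def)
      then have "a \<in> W (m + p * c)" "winv r \<in> W (m + p * c)" "r \<in> W (m + p * c + c)"
        using a r winv by (auto intro: mono[rotated])
      then have "r @ (a @ winv r) \<in> W (m + p * c + c + c)" by (intro append)
      then show ?thesis by (simp add: add.assoc mult_2)
    qed
    ultimately show False using x(2) N2_eq by (metis N2_class_eq_iff)
  qed
  then obtain q where q: "\<not> int p dvd cnt q y" by blast
  have "echelon p (xs @ [y]) (qs @ [q])"
    using xs(2) es(2) q by (intro echelon_snoc) (auto simp: y_def r_def)
  moreover have "power_prod (xs @ [y]) fs \<in> W (n0 + Suc k * (C + 4 * c + 2 * p * c))"
    if fs_in: "fs \<in> exps p (Suc k)" for fs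
  proof -
    obtain gs e where fs: "fs = gs @ [e]" using fs_in by (cases fs rule: rev_cases) (auto simp: exps_def)
    have ge: "gs \<in> exps p k" "e < p" using fs_in by (auto simp: fs exps_def)
    have "concat (replicate e y) \<in> W (?m + C + c + p * c)"
      using y ge by (intro power_le) (auto simp: m_def)
    moreover have "power_prod xs gs \<in> W (?m + C + c + p * c)"
      using xs(3)[OF ge(1)] by (auto intro: mono[rotated])
    ultimately have "power_prod xs gs @ concat (replicate e y) \<in> W (?m + C + c + p * c + c)"
      by (intro append)
    \<comment> \<open>One step costs \<open>p * c + 2 * c\<close> up to \<open>?m\<close>,
      \<open>C\<close> for the escape, \<open>c\<close> for the factor \<open>r\<close>,
      \<open>p * c\<close> for the power of \<open>y\<close> and \<open>c\<close> for the last
      product.\<close>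
    moreover have "?m + C + c + p * c + c = n0 + Suc k * (C + 4 * c + 2 * p * c)"
      by (simp add: m_def algebra_simps)
    moreover have "length gs = length xs" using ge xs(1) by (simp add: exps_def)
    ultimately show ?thesis by (simp only: fs power_prod_snoc)
  qed
  ultimately show ?case
    using xs(1) by (intro exI[of _ "xs @ [y]"] exI[of _ "qs @ [q]"]) auto
qed

end

section \<open>Infinitely many conjugates and the final count\<close>

text \<open>Conjugates by the other generators differ: \<open>area 0 (Suc i)\<close> is 1 on
  \<open>g i\<close> and 0 on every other \<open>g j\<close>.\<close>

lemma infinite_conjugates:
  assumes "prime p" "odd p"
  shows "infinite ((\<lambda>x. inv\<^bsub>F_infinity p\<^esub> x \<otimes>\<^bsub>F_infinity p\<^esub> F_gen p 0 \<otimes>\<^bsub>F_infinity p\<^esub> x) ` carrier (F_infinity p))"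
proof -
  define g where "g i = [(Suc i, False), (0, True), (Suc i, True)]" for i
  have "inj (\<lambda>i. N2_class p (g i))"
  proof (rule injI)
    fix i j assume "N2_class p (g i) = N2_class p (g j)"
    then have "[area 0 (Suc i) (g i) = area 0 (Suc i) (g j)] (mod int p)"
      using assms(2) by (intro area_cong) (simp_all add: N2_class_eq_iff)
    then show "i = j"
      using prime_gt_1_nat[OF assms(1)] by (auto simp: g_def letter_exp_def cong_0_iff split: if_splits)
  qed
  then have "infinite (range (\<lambda>i. N2_class p (g i)))" by (simp add: finite_image_iff)
  moreover have "N2_class p (g i) \<in> (\<lambda>x. inv\<^bsub>F_infinity p\<^esub> x \<otimes>\<^bsub>F_infinity p\<^esub> F_gen p 0 \<otimes>\<^bsub>F_infinity p\<^esub> x) ` carrier (F_infinity p)" for i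
    by (rule image_eqI[of _ _ "N2_class p [(Suc i, True)]"])
      (auto simp: g_def F_gen_def F_inv F_mult F_carrier winv_def)
  ultimately show ?thesis by (meson finite_subset image_subsetI)
qed

lemma quadratic_exceeds_linear:
  fixes A b :: nat
  shows "\<exists>k. A + b * k < (\<Sum>i<k. i)"
proof -
  \<comment> \<open>Chosen so that \<open>k (k - 1) / 2\<close> is exactly
    \<open>(A + b + 1) k\<close>.\<close>
  define k where "k = 2 * (A + b) + 3"
  have "(A + b + 1) * k = (\<Sum>i<k. i)"
    using Sum_Ico_nat[of 0 k] by (simp add: k_def atLeast0LessThan algebra_simps)
  moreover have "A + b * k < (A + b + 1) * k" by (simp add: k_def algebra_simps)
  ultimately show ?thesis by metis
qed

theorem theorem3p1:
  fixes p :: nat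
  assumes "prime p" and "odd p"
  shows "\<not> word_automatic (F_infinity p)"
proof
  assume wa: "word_automatic (F_infinity p)"
  interpret group "F_infinity p" by (rule group_F_infinity)
  let ?F = "F_infinity p"
  obtain B :: "nat \<Rightarrow> gword set set" and c s where
    B: "\<forall>m. finite (B m) \<and> card (B m) \<le> s ^ m" "mono B" "(\<Union>m. B m) = carrier ?F"
      "\<forall>m. \<forall>x\<in>B m. \<forall>y\<in>B m. x \<otimes>\<^bsub>?F\<^esub> y \<in> B (m + c)"
    and esc: "\<forall>a\<in>carrier ?F.
      infinite ((\<lambda>x. inv\<^bsub>?F\<^esub> x \<otimes>\<^bsub>?F\<^esub> a \<otimes>\<^bsub>?F\<^esub> x) ` carrier ?F) \<longrightarrow>
      (\<exists>C m0. \<forall>m\<ge>m0. \<exists>x\<in>B (m + C). inv\<^bsub>?F\<^esub> x \<otimes>\<^bsub>?F\<^esub> a \<otimes>\<^bsub>?F\<^esub> x \<notin> B m)"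
    using word_automatic_growth[OF wa group_F_infinity] by (elim exE conjE)
  have fin: "finite (B m)" and card: "card (B m) \<le> s ^ m" for m using B(1) by auto
  have mult: "x \<otimes>\<^bsub>?F\<^esub> y \<in> B (m + c)" if "x \<in> B m" "y \<in> B m" for x y m
    using B(4) that by blast
  define a where "a = [(0 :: nat, True)]"
  have "F_gen p 0 \<in> carrier ?F" by (simp add: F_gen_def F_carrier)
  with esc infinite_conjugates[OF assms] obtain C m0 where C: "\<And>m. m0 \<le> m \<Longrightarrow>
      \<exists>x\<in>B (m + C). inv\<^bsub>?F\<^esub> x \<otimes>\<^bsub>?F\<^esub> F_gen p 0 \<otimes>\<^bsub>?F\<^esub> x \<notin> B m"
    by blast
  have "N2_class p [] \<in> (\<Union>m. B m)" "N2_class p a \<in> (\<Union>m. B m)"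
    unfolding B(3) by (auto simp: F_carrier)
  then obtain m1 m2 where m12: "N2_class p [] \<in> B m1" "N2_class p a \<in> B m2" by blast
  \<comment> \<open>Large enough for the escape property and for the ball to contain both the
    identity and the generator.\<close>
  define n0 where "n0 = m0 + m1 + m2"
  define W where "W m = {w. N2_class p w \<in> B m}" for m
  have B_mono: "x \<in> B n" if "x \<in> B m" "m \<le> n" for x m n
    using B(2) that by (auto simp: mono_def)
  interpret word_growth p W c n0
  proof
    show "u \<in> W m \<Longrightarrow> v \<in> W m \<Longrightarrow> u @ v \<in> W (m + c)" for u v m
      using mult[of "N2_class p u" m "N2_class p v"] by (simp add: W_def F_mult)
    show "N2_eq p u v \<Longrightarrow> u \<in> W m \<Longrightarrow> v \<in> W m" for u v m
      by (simp add: W_def flip: N2_class_eq_iff)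
  qed (use assms m12 in \<open>auto simp: W_def n0_def intro: B_mono\<close>)
  have aW: "a \<in> W n0"
    unfolding W_def mem_Collect_eq by (rule B_mono[OF m12(2)]) (simp add: n0_def)
  have escW: "\<exists>x\<in>W (m + C). winv x @ a @ x \<notin> W m" if "n0 \<le> m" for m
  proof -
    have "m0 \<le> m" using that by (simp add: n0_def)
    obtain X where X: "X \<in> B (m + C)" "inv\<^bsub>?F\<^esub> X \<otimes>\<^bsub>?F\<^esub> F_gen p 0 \<otimes>\<^bsub>?F\<^esub> X \<notin> B m"
      using C[of m] \<open>m0 \<le> m\<close> by blast
    obtain x where "X = N2_class p x" using X(1) B(3) by (auto simp: F_carrier)
    then show ?thesis
      using X by (intro bexI[of _ x]) (auto simp: W_def F_gen_def F_inv F_mult a_def)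
  qed
  let ?\<alpha> = "C + 4 * c + 2 * p * c"
  \<comment> \<open>The \<open>k (k - 1) / 2\<close> independent exponents must fit into a ball of
    radius linear in \<open>k\<close>.\<close>
  have bound: "(\<Sum>i<k. i) \<le> s * (n0 + p * c + 3 * c) + s * (?\<alpha> + c) * k" for k
  proof -
    let ?m = "n0 + k * ?\<alpha>"
    let ?n = "?m + p * c + 3 * c + k * c"
    obtain xs qs where xs: "length xs = k" "echelon p xs qs"
      "\<forall>es\<in>exps p k. power_prod xs es \<in> W ?m"
      using echelon_extend[OF aW escW] by blast
    have "comm_prods p xs \<subseteq> W ?n" using comm_prods[of xs ?m] xs by simp
    then have sub: "N2_class p ` comm_prods p xs \<subseteq> B ?n" by (auto simp: W_def)
    have p: "1 < p" using assms(1) by (rule prime_gt_1_nat)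
    have "p ^ (\<Sum>i<k. i) \<le> card (N2_class p ` comm_prods p xs)"
      using card_comm_prods[OF assms xs(2)] xs(1) by simp
    also have "\<dots> \<le> card (B ?n)" using fin sub by (rule card_mono)
    also have "\<dots> \<le> s ^ ?n" by (rule card)
    \<comment> \<open>Replacing \<open>s\<close> by the larger \<open>p ^ s\<close> makes both sides
      powers of \<open>p\<close>, so that the exponents can be compared.\<close>
    also have "\<dots> \<le> (p ^ s) ^ ?n"
      using less_imp_le[OF power_gt_expt[of p s, unfolded One_nat_def[symmetric], OF p]] by (rule power_mono) simp
    also have "\<dots> = p ^ (s * ?n)" by (rule power_mult[symmetric])
    finally have "(\<Sum>i<k. i) \<le> s * ?n" by (rule power_le_imp_le_exp[OF p])
    then show ?thesis by (simp add: algebra_simps)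
  qed
  obtain k where "s * (n0 + p * c + 3 * c) + s * (?\<alpha> + c) * k < (\<Sum>i<k. i)"
    using quadratic_exceeds_linear by blast
  with bound[of k] show False by simp
qed

end
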